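(* Let $m_i=\mathrm M(\mu_i)\in\mathbb R^d$ and $\sigma_i^2=\operatorname{var}(\mu_i)$, $\sigma_i>0$, for $i=0,1$, be the means and variances of $\mu_0,\mu_1\in\mathcal P_2(\mathbb R^d)$, and set $n=|m_1-m_0|$. Then $$\mathcal D^{\mathrm{var}}(\mu_0,\mu_1)^2=\frac12\left|\log\left(\frac{n^2+\sigma_0^2+\sigma_1^2-\sqrt{(n^2+\sigma_0^2+\sigma_1^2)^2-4\sigma_0^2\sigma_1^2}}{2\sigma_0\sigma_1}\right)\right|^2 .$$ Further, in the case $n>0$, the optimal curves are given by $$m(t)=m_0+(m_1-m_0)\frac{\tanh(\beta t+t_0)-\tanh(t_0)}{\tanh(\beta+t_0)-\tanh(t_0)},\qquad \sigma(t)=\frac{n}{\tanh(\beta+t_0)-\tanh(t_0)}\cdot\frac1{\cosh(\beta t+t_0)},$$ with $\beta=\sqrt2\,\mathcal D^{\mathrm{var}}(\mu_0,\mu_1)\ge0$ and $$t_0=\log\left(\frac{\sigma_0^2-\sigma_1^2-n^2+\sqrt{(n^2+\sigma_0^2+\sigma_1^2)^2-4\sigma_0^2\sigma_1^2}}{2n\sigma_0}\right)\ge0.$$ For $m_0=m_1=m$ (i.e. $n=0$), the optimal curves are given by $m(t)=m$ and $\sigma(t)=\sigma_0^{1-t}\sigma_1^t$.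
   Context: $\mathcal P_2(\mathbb R^d)$: Borel probability measures with finite second moment; $\mathrm M(\mu)=\int x\,d\mu$; $\operatorname{var}(\mu)=\int|x-\mathrm M(\mu)|^2d\mu$. $\mathcal D^{\mathrm{var}}(\mu_0,\mu_1)^2=\inf\int_0^1\frac{|\dot m_t|^2+|\dot\sigma_t|^2}{2\sigma_t^2}dt$ over absolutely continuous $m:[0,1]\to\mathbb R^d$, $\sigma:[0,1]\to[0,\infty)$ with $m(i)=\mathrm M(\mu_i)$, $\sigma(i)^2=\operatorname{var}(\mu_i)$, $i=0,1$. Optimal curves are the minimizers $(m,\sigma)$ of this problem.
   Formalization: The claim t_0≥0 is false in general (n=σ_0=σ_1=1 gives exp t_0=(√5−1)/2<1); it is replaced by: t_0≥0 if and only if n²+σ_1²≤σ_0². The distance formula and the optimal curves are proved for every sign of t_0. *)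

theory Defs
  imports "HOL-Analysis.Analysis" "HOL-Probability.Probability_Measure"
begin

definition P2 :: "'a::euclidean_space measure set" where
  "P2 = {\<mu>. prob_space \<mu> \<and> sets \<mu> = sets borel \<and> integrable \<mu> (\<lambda>x. (norm x)\<^sup>2)}"

definition mean :: "'a::euclidean_space measure \<Rightarrow> 'a" where
  "mean \<mu> = (LINT x|\<mu>. x)"

definition var :: "'a::euclidean_space measure \<Rightarrow> real" where
  "var \<mu> = (LINT x|\<mu>. (norm (x - mean \<mu>))\<^sup>2)"

text \<open>The usual epsilon-delta definition. A \<open>division_of\<close> is a finite family of nonempty compact
  intervals with pairwise disjoint interiors; \<open>Inf k\<close> and \<open>Sup k\<close> are the endpoints of \<open>k\<close>.\<close>

definition abs_cont_on :: "real \<Rightarrow> real \<Rightarrow> (real \<Rightarrow> 'a::real_normed_vector) \<Rightarrow> bool" where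
  "abs_cont_on a b f \<longleftrightarrow>
     (\<forall>\<epsilon>>0. \<exists>\<delta>>0. \<forall>\<D> S. \<D> division_of S \<longrightarrow> S \<subseteq> {a..b} \<longrightarrow> (\<Sum>k\<in>\<D>. Sup k - Inf k) < \<delta> \<longrightarrow>
        (\<Sum>k\<in>\<D>. norm (f (Sup k) - f (Inf k))) < \<epsilon>)"

definition admissible ::
  "'a::euclidean_space measure \<Rightarrow> 'a measure \<Rightarrow> (real \<Rightarrow> 'a) \<Rightarrow> (real \<Rightarrow> real) \<Rightarrow> bool" where
  "admissible \<mu>0 \<mu>1 m \<sigma> \<longleftrightarrow>
     abs_cont_on 0 1 m \<and> abs_cont_on 0 1 \<sigma> \<and> (\<forall>t\<in>{0..1}. 0 \<le> \<sigma> t) \<and>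
     m 0 = mean \<mu>0 \<and> m 1 = mean \<mu>1 \<and> (\<sigma> 0)\<^sup>2 = var \<mu>0 \<and> (\<sigma> 1)\<^sup>2 = var \<mu>1"

text \<open>The derivatives exist almost everywhere for absolutely continuous curves. The quotient is taken
  in \<^typ>\<open>ennreal\<close>, so where \<open>\<sigma> t = 0\<close> the integrand is infinite unless the numerator vanishes.\<close>

definition action :: "(real \<Rightarrow> 'a::euclidean_space) \<Rightarrow> (real \<Rightarrow> real) \<Rightarrow> ennreal" where
  "action m \<sigma> = (\<integral>\<^sup>+t\<in>{0..1}.
     (ennreal ((norm (vector_derivative m (at t within {0..1})))\<^sup>2
               + (vector_derivative \<sigma> (at t within {0..1}))\<^sup>2)
      / ennreal (2 * (\<sigma> t)\<^sup>2)) \<partial>lborel)"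

text \<open>The squared distance is an extended real; the distance itself is its real square root, which
  is meaningful only when the infimum is finite.\<close>

definition Dvar_sq :: "'a::euclidean_space measure \<Rightarrow> 'a measure \<Rightarrow> ennreal" where
  "Dvar_sq \<mu>0 \<mu>1 = (INF (m, \<sigma>)\<in>{(m, \<sigma>). admissible \<mu>0 \<mu>1 m \<sigma>}. action m \<sigma>)"

definition Dvar :: "'a::euclidean_space measure \<Rightarrow> 'a measure \<Rightarrow> real" where
  "Dvar \<mu>0 \<mu>1 = sqrt (enn2real (Dvar_sq \<mu>0 \<mu>1))"

definition optimal_curve ::
  "'a::euclidean_space measure \<Rightarrow> 'a measure \<Rightarrow> (real \<Rightarrow> 'a) \<Rightarrow> (real \<Rightarrow> real) \<Rightarrow> bool" where
  "optimal_curve \<mu>0 \<mu>1 m \<sigma> \<longleftrightarrow> admissible \<mu>0 \<mu>1 m \<sigma> \<and> action m \<sigma> = Dvar_sq \<mu>0 \<mu>1"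

end

theory Submission
  imports Defs
begin

text \<open>
  Up to the factor \<open>1/2\<close> the action is the energy of the curve \<open>(m, \<sigma>)\<close> in the hyperbolic upper half
  space with metric \<open>(|dm|\<^sup>2 + d\<sigma>\<^sup>2) / \<sigma>\<^sup>2\<close>. Hence the minimal action is half the squared hyperbolic
  distance of the endpoints, and the minimizers are the constant speed geodesics: semicircles that
  meet the boundary \<open>\<sigma> = 0\<close> orthogonally if the means differ, and vertical segments if they agree.

  Minimality is shown by a calibration. Along an admissible curve of finite action one finds a
  scalar function \<open>u\<close> such that the squared hyperbolic speed is \<open>u'\<^sup>2\<close> plus a nonnegative remainder.
  Then the action is at least \<open>(u 1 - u 0)\<^sup>2 / 2\<close>, with equality only if \<open>u\<close> is affine and the
  remainder vanishes almost everywhere (\<open>energy_bound\<close>). For equal means \<open>u = ln \<sigma>\<close>, and the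
  remainder measures the motion of \<open>m\<close> (\<open>log_energy_bound\<close>). For different means, let \<open>x\<close> be the
  coordinate of \<open>m\<close> in the direction of \<open>m1 - m0\<close>, with its origin at the centre of the semicircle
  through the endpoints; then \<open>u = arsinh (x / \<sigma>)\<close>, and the remainder measures the change of
  \<open>x\<^sup>2 + \<sigma>\<^sup>2\<close> together with the motion of \<open>m\<close> orthogonal to \<open>m1 - m0\<close>
  (\<open>hyperbolic_energy_bound\<close>). In both cases the equality conditions integrate to the explicit
  curves, and these attain the bound because they have constant speed (\<open>constant_speed_action\<close>). The
  logarithms of the statement come out of \<open>arsinh\<close> at the endpoints (\<open>semicircle_parameters\<close>).

  Dividing by \<open>\<sigma>\<close> is legitimate because a curve of finite action cannot reach \<open>\<sigma> = 0\<close>: the function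
  \<open>ln \<sigma>\<close> would tend to \<open>-\<infinity>\<close> in finite time at finite energy (\<open>finite_action_imp_positive\<close>).

  Competitors are merely absolutely continuous, so the argument rests on two facts of real analysis.
  Absolutely continuous curves are differentiable almost everywhere
  (\<open>abs_cont_on_differentiable_AE\<close>): by Vitali's covering theorem, the points where difference
  quotients are unbounded, and those where they oscillate between two rationals, form null sets. And
  they are recovered from their derivative by integration (\<open>abs_cont_on_has_integral\<close>).
\<close>

section \<open>Finite families of intervals\<close>

lemma division_cell_real:
  fixes S :: "real set"
  assumes "D division_of S" "k \<in> D"
  shows "k = {Inf k..Sup k}" "Inf k \<le> Sup k" "{Inf k..Sup k} \<subseteq> S"
proof -
  obtain u v where k: "k = cbox u v"
    using division_ofD(4)[OF assms] by blast
  moreover have "k \<noteq> {}" "k \<subseteq> S"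
    using division_ofD(2,3)[OF assms] by auto
  ultimately show "k = {Inf k..Sup k}" "Inf k \<le> Sup k" "{Inf k..Sup k} \<subseteq> S"
    by auto
qed

lemma sum_lengths_eq_measure:
  fixes S :: "real set"
  assumes "D division_of S"
  shows "(\<Sum>k\<in>D. Sup k - Inf k) = measure lebesgue S"
proof -
  have "(\<Sum>k\<in>D. Sup k - Inf k) = (\<Sum>k\<in>D. measure lebesgue k)"
  proof (rule sum.cong)
    fix k assume "k \<in> D"
    note division_cell_real[OF assms this]
    then show "Sup k - Inf k = measure lebesgue k"
      by (metis content_real measure_completion atLeastAtMost_borel sets_lborel)
  qed simp
  then show ?thesis
    using content_division[OF assms] by simp
qed

lemma sum_increments_division:
  fixes f :: "real \<Rightarrow> 'a::real_normed_vector"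
  assumes "a \<le> b" "D division_of {a..b}"
  shows "(\<Sum>k\<in>D. f (Sup k) - f (Inf k)) = f b - f a"
proof -
  define p where "p = (\<lambda>k. (Inf k, k)) ` D"
  have "Inf k \<in> k" if "k \<in> D" for k
    using division_cell_real[OF assms(2) that] by (metis atLeastAtMost_iff order_refl)
  moreover have "p tagged_division_of {a..b}" if "\<And>k. k \<in> D \<Longrightarrow> Inf k \<in> k"
  proof (rule tagged_division_ofI)
    show "finite p" "\<Union>{K. \<exists>x. (x, K) \<in> p} = {a..b}"
      using division_ofD(1,6)[OF assms(2)] by (auto simp: p_def image_iff)
    show "x \<in> K" "K \<subseteq> {a..b}" "\<exists>a b. K = cbox a b" if "(x, K) \<in> p" for x K
    proof -
      have "K \<in> D" "x = Inf K"
        using that by (auto simp: p_def)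
      then show "x \<in> K" "K \<subseteq> {a..b}" "\<exists>a b. K = cbox a b"
        using division_ofD(2,4)[OF assms(2) \<open>K \<in> D\<close>] \<open>\<And>k. k \<in> D \<Longrightarrow> Inf k \<in> k\<close>[OF \<open>K \<in> D\<close>] by simp_all
    qed
    show "interior K1 \<inter> interior K2 = {}"
      if "(x1, K1) \<in> p" "(x2, K2) \<in> p" "(x1, K1) \<noteq> (x2, K2)" for x1 K1 x2 K2
      using that division_ofD(5)[OF assms(2), of K1 K2] by (auto simp: p_def)
  qed
  ultimately have "p tagged_division_of {a..b}"
    by blast
  from additive_tagged_division_1[OF assms(1) this, of f] show ?thesis
    by (simp add: p_def sum.reindex inj_on_def)
qed

section \<open>Absolutely continuous curves\<close>

lemma abs_cont_onD:
  assumes "abs_cont_on a b f" "0 < \<epsilon>"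
  obtains \<delta> where "0 < \<delta>"
    "\<And>D S. D division_of S \<Longrightarrow> S \<subseteq> {a..b} \<Longrightarrow> (\<Sum>k\<in>D. Sup k - Inf k) < \<delta>
        \<Longrightarrow> (\<Sum>k\<in>D. norm (f (Sup k) - f (Inf k))) < \<epsilon>"
  using assms unfolding abs_cont_on_def by metis

lemma abs_cont_on_subinterval:
  assumes "abs_cont_on a b f" "a \<le> c" "d \<le> b"
  shows "abs_cont_on c d f"
  unfolding abs_cont_on_def
proof (intro allI impI)
  fix \<epsilon> :: real assume "0 < \<epsilon>"
  obtain \<delta> where "0 < \<delta>" and \<delta>: "\<And>D S. D division_of S \<Longrightarrow> S \<subseteq> {a..b} \<Longrightarrow> (\<Sum>k\<in>D. Sup k - Inf k) < \<delta>
        \<Longrightarrow> (\<Sum>k\<in>D. norm (f (Sup k) - f (Inf k))) < \<epsilon>"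
    using abs_cont_onD[OF assms(1) \<open>0 < \<epsilon>\<close>] by metis
  have sub: "{c..d} \<subseteq> {a..b}"
    using assms by auto
  show "\<exists>\<delta>>0. \<forall>\<D> S. \<D> division_of S \<longrightarrow> S \<subseteq> {c..d} \<longrightarrow> (\<Sum>k\<in>\<D>. Sup k - Inf k) < \<delta> \<longrightarrow>
        (\<Sum>k\<in>\<D>. norm (f (Sup k) - f (Inf k))) < \<epsilon>"
    by (intro exI[of _ \<delta>] conjI allI impI \<open>0 < \<delta>\<close> \<delta>) (assumption, rule order_trans[OF _ sub], assumption+)
qed

text \<open>Every closure property of absolute continuity below is an instance of this one: an increment of
  the new function is controlled by the increments of two old ones, cell by cell.\<close>

lemma abs_cont_on_dominated:
  assumes f: "abs_cont_on a b f" and g: "abs_cont_on a b g"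
    and bound: "\<And>s t. \<lbrakk>a \<le> s; s \<le> t; t \<le> b\<rbrakk> \<Longrightarrow> norm (h t - h s) \<le> L * (norm (f t - f s) + norm (g t - g s))"
  shows "abs_cont_on a b h"
  unfolding abs_cont_on_def
proof (intro allI impI)
  fix \<epsilon> :: real assume "0 < \<epsilon>"
  define M where "M = max L 1"
  define \<eta> where "\<eta> = \<epsilon> / (2 * M)"
  have "0 < M" "0 < \<eta>"
    using \<open>0 < \<epsilon>\<close> by (auto simp: M_def \<eta>_def less_max_iff_disj)
  obtain \<delta>1 where \<delta>1: "0 < \<delta>1" "\<And>D S. D division_of S \<Longrightarrow> S \<subseteq> {a..b} \<Longrightarrow> (\<Sum>k\<in>D. Sup k - Inf k) < \<delta>1
        \<Longrightarrow> (\<Sum>k\<in>D. norm (f (Sup k) - f (Inf k))) < \<eta>"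
    using abs_cont_onD[OF f \<open>0 < \<eta>\<close>] by metis
  obtain \<delta>2 where \<delta>2: "0 < \<delta>2" "\<And>D S. D division_of S \<Longrightarrow> S \<subseteq> {a..b} \<Longrightarrow> (\<Sum>k\<in>D. Sup k - Inf k) < \<delta>2
        \<Longrightarrow> (\<Sum>k\<in>D. norm (g (Sup k) - g (Inf k))) < \<eta>"
    using abs_cont_onD[OF g \<open>0 < \<eta>\<close>] by metis
  show "\<exists>\<delta>>0. \<forall>\<D> S. \<D> division_of S \<longrightarrow> S \<subseteq> {a..b} \<longrightarrow> (\<Sum>k\<in>\<D>. Sup k - Inf k) < \<delta> \<longrightarrow>
        (\<Sum>k\<in>\<D>. norm (h (Sup k) - h (Inf k))) < \<epsilon>"
  proof (intro exI[of _ "min \<delta>1 \<delta>2"] conjI allI impI)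
    fix D S assume D: "D division_of S" "S \<subseteq> {a..b}" "(\<Sum>k\<in>D. Sup k - Inf k) < min \<delta>1 \<delta>2"
    have "norm (h (Sup k) - h (Inf k)) \<le> M * (norm (f (Sup k) - f (Inf k)) + norm (g (Sup k) - g (Inf k)))"
      if "k \<in> D" for k
    proof -
      have "Inf k \<le> Sup k" "{Inf k..Sup k} \<subseteq> {a..b}"
        using division_cell_real[OF D(1) that] D(2) by auto
      then have "norm (h (Sup k) - h (Inf k)) \<le> L * (norm (f (Sup k) - f (Inf k)) + norm (g (Sup k) - g (Inf k)))"
        by (intro bound) auto
      also have "\<dots> \<le> M * (norm (f (Sup k) - f (Inf k)) + norm (g (Sup k) - g (Inf k)))"
        by (intro mult_right_mono) (auto simp: M_def)
      finally show ?thesis .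
    qed
    then have "(\<Sum>k\<in>D. norm (h (Sup k) - h (Inf k)))
        \<le> (\<Sum>k\<in>D. M * (norm (f (Sup k) - f (Inf k)) + norm (g (Sup k) - g (Inf k))))"
      by (rule sum_mono)
    also have "\<dots> = M * ((\<Sum>k\<in>D. norm (f (Sup k) - f (Inf k))) + (\<Sum>k\<in>D. norm (g (Sup k) - g (Inf k))))"
      by (simp add: sum_distrib_left[symmetric] sum.distrib)
    also have "\<dots> < M * (\<eta> + \<eta>)"
      using D \<delta>1(2)[OF D(1,2)] \<delta>2(2)[OF D(1,2)] \<open>0 < M\<close> by (intro mult_strict_left_mono add_strict_mono) auto
    also have "\<dots> = \<epsilon>"
      using \<open>0 < M\<close> by (simp add: \<eta>_def)
    finally show "(\<Sum>k\<in>D. norm (h (Sup k) - h (Inf k))) < \<epsilon>" .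
  qed (use \<delta>1 \<delta>2 in auto)
qed

lemma abs_cont_on_ident: "abs_cont_on a b (\<lambda>t. t)"
  unfolding abs_cont_on_def
proof (intro allI impI)
  fix \<epsilon> :: real assume "0 < \<epsilon>"
  have "(\<Sum>k\<in>D. norm (Sup k - Inf k)) < \<epsilon>"
    if D: "D division_of S" "(\<Sum>k\<in>D. Sup k - Inf k) < \<epsilon>" for D and S :: "real set"
  proof -
    have "(\<Sum>k\<in>D. norm (Sup k - Inf k)) = (\<Sum>k\<in>D. Sup k - Inf k)"
      using division_cell_real(2)[OF D(1)] by (intro sum.cong) auto
    then show ?thesis
      using D(2) by simp
  qed
  with \<open>0 < \<epsilon>\<close> show "\<exists>\<delta>>0. \<forall>\<D> S. \<D> division_of S \<longrightarrow> S \<subseteq> {a..b} \<longrightarrow> (\<Sum>k\<in>\<D>. Sup k - Inf k) < \<delta> \<longrightarrow>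
        (\<Sum>k\<in>\<D>. norm (Sup k - Inf k)) < \<epsilon>"
    by blast
qed

lemma abs_cont_on_lipschitz:
  assumes "\<And>s t. \<lbrakk>a \<le> s; s \<le> t; t \<le> b\<rbrakk> \<Longrightarrow> norm (h t - h s) \<le> L * (t - s)"
  shows "abs_cont_on a b h"
proof (rule abs_cont_on_dominated[where L = "L / 2"])
  show "norm (h t - h s) \<le> L / 2 * (norm (t - s) + norm (t - s))" if "a \<le> s" "s \<le> t" "t \<le> b" for s t
    using assms[OF that] that by (simp add: field_simps)
qed (rule abs_cont_on_ident)+

lemma abs_cont_on_compose_lipschitz:
  assumes f: "abs_cont_on a b f"
    and bound: "\<And>s t. \<lbrakk>a \<le> s; s \<le> t; t \<le> b\<rbrakk> \<Longrightarrow> norm (h t - h s) \<le> L * norm (f t - f s)"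
  shows "abs_cont_on a b h"
  by (rule abs_cont_on_dominated[OF f f, where L = "L / 2"]) (use bound in auto)

lemma abs_cont_on_add:
  assumes "abs_cont_on a b f" "abs_cont_on a b g"
  shows "abs_cont_on a b (\<lambda>t. f t + g t)"
  by (rule abs_cont_on_dominated[OF assms, where L = 1])
    (metis add_diff_add mult_1 norm_triangle_ineq)

lemma abs_cont_on_continuous:
  assumes f: "abs_cont_on a b f"
  shows "continuous_on {a..b} f"
  unfolding continuous_on_iff
proof (intro ballI allI impI)
  fix x \<epsilon> :: real assume x: "x \<in> {a..b}" and "0 < \<epsilon>"
  obtain \<delta> where \<delta>: "0 < \<delta>" "\<And>D S. D division_of S \<Longrightarrow> S \<subseteq> {a..b} \<Longrightarrow> (\<Sum>k\<in>D. Sup k - Inf k) < \<delta>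
        \<Longrightarrow> (\<Sum>k\<in>D. norm (f (Sup k) - f (Inf k))) < \<epsilon>"
    using abs_cont_onD[OF f \<open>0 < \<epsilon>\<close>] by metis
  have small: "norm (f t - f s) < \<epsilon>" if "a \<le> s" "s \<le> t" "t \<le> b" "t - s < \<delta>" for s t
  proof -
    have "{cbox s t} division_of cbox s t"
      using that by (intro division_of_self) auto
    then show ?thesis
      using \<delta>(2)[of "{{s..t}}" "{s..t}"] that by simp
  qed
  show "\<exists>d>0. \<forall>y\<in>{a..b}. dist y x < d \<longrightarrow> dist (f y) (f x) < \<epsilon>"
  proof (intro exI[of _ \<delta>] conjI ballI impI)
    fix y assume "y \<in> {a..b}" "dist y x < \<delta>"
    then show "dist (f y) (f x) < \<epsilon>"
      using small[of x y] small[of y x] x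
      by (cases "x \<le> y") (auto simp: dist_norm norm_minus_commute)
  qed (use \<delta> in auto)
qed

lemma abs_cont_on_bounded:
  assumes "abs_cont_on a b f"
  obtains B where "0 < B" "\<And>t. t \<in> {a..b} \<Longrightarrow> norm (f t) \<le> B"
proof -
  have "bounded (f ` {a..b})"
    using abs_cont_on_continuous[OF assms] by (intro compact_imp_bounded compact_continuous_image) auto
  then show ?thesis
    using that by (auto simp: bounded_pos)
qed

lemma abs_cont_on_mult:
  fixes f g :: "real \<Rightarrow> real"
  assumes f: "abs_cont_on a b f" and g: "abs_cont_on a b g"
  shows "abs_cont_on a b (\<lambda>t. f t * g t)"
proof -
  obtain B C where B: "0 < B" "\<And>t. t \<in> {a..b} \<Longrightarrow> norm (f t) \<le> B"
    and C: "0 < C" "\<And>t. t \<in> {a..b} \<Longrightarrow> norm (g t) \<le> C"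
    using abs_cont_on_bounded[OF f] abs_cont_on_bounded[OF g] by metis
  show ?thesis
  proof (rule abs_cont_on_dominated[OF f g, where L = "B + C"])
    fix s t assume st: "a \<le> s" "s \<le> t" "t \<le> b"
    have "f t * g t - f s * g s = f t * (g t - g s) + (f t - f s) * g s"
      by (simp add: algebra_simps)
    then have "norm (f t * g t - f s * g s) \<le> norm (f t) * norm (g t - g s) + norm (f t - f s) * norm (g s)"
      by (metis norm_mult norm_triangle_ineq)
    also have "\<dots> \<le> (B + C) * norm (g t - g s) + norm (f t - f s) * (B + C)"
    proof -
      have "norm (f t) \<le> B + C" "norm (g s) \<le> B + C"
        using B(2)[of t] C(2)[of s] B(1) C(1) st by auto
      then show ?thesis
        by (meson add_mono mult_left_mono mult_right_mono norm_ge_zero)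
    qed
    also have "\<dots> = (B + C) * (norm (f t - f s) + norm (g t - g s))"
      by (simp add: algebra_simps)
    finally show "norm (f t * g t - f s * g s) \<le> (B + C) * (norm (f t - f s) + norm (g t - g s))" .
  qed
qed

text \<open>The logarithm is Lipschitz with constant \<open>1 / \<delta>\<close> on \<open>[\<delta>, \<infinity>)\<close>, by
  \<open>ln z \<le> z - 1\<close> applied to \<open>z = y / x\<close>.\<close>

lemma abs_cont_on_ln:
  fixes f :: "real \<Rightarrow> real"
  assumes f: "abs_cont_on a b f" and "0 < \<delta>" and lower: "\<And>t. t \<in> {a..b} \<Longrightarrow> \<delta> \<le> f t"
  shows "abs_cont_on a b (\<lambda>t. ln (f t))"
proof (rule abs_cont_on_compose_lipschitz[OF f, where L = "1 / \<delta>"])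
  have one: "ln y - ln x \<le> 1 / \<delta> * \<bar>y - x\<bar>" if "\<delta> \<le> x" "\<delta> \<le> y" for x y
  proof -
    have "ln y - ln x = ln (y / x)"
      using that \<open>0 < \<delta>\<close> by (simp add: ln_div)
    also have "\<dots> \<le> y / x - 1"
      using that \<open>0 < \<delta>\<close> by (intro ln_le_minus_one) simp
    also have "\<dots> = (y - x) / x"
      using that \<open>0 < \<delta>\<close> by (simp add: field_simps)
    also have "\<dots> \<le> \<bar>y - x\<bar> / x"
      using that \<open>0 < \<delta>\<close> by (intro divide_right_mono) auto
    also have "\<dots> \<le> \<bar>y - x\<bar> / \<delta>"
      using that \<open>0 < \<delta>\<close> by (intro divide_left_mono) auto
    finally show ?thesis by simp
  qed
  fix s t assume "a \<le> s" "s \<le> t" "t \<le> b"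
  then have "\<delta> \<le> f s" "\<delta> \<le> f t"
    using lower by auto
  from one[OF this] one[OF this(2,1)]
  show "norm (ln (f t) - ln (f s)) \<le> 1 / \<delta> * norm (f t - f s)"
    by (simp add: abs_le_iff abs_minus_commute)
qed

lemma abs_cont_on_inverse:
  fixes f :: "real \<Rightarrow> real"
  assumes f: "abs_cont_on a b f" and "0 < \<delta>" and lower: "\<And>t. t \<in> {a..b} \<Longrightarrow> \<delta> \<le> f t"
  shows "abs_cont_on a b (\<lambda>t. inverse (f t))"
proof (rule abs_cont_on_compose_lipschitz[OF f, where L = "1 / \<delta>\<^sup>2"])
  fix s t assume "a \<le> s" "s \<le> t" "t \<le> b"
  then have st: "\<delta> \<le> f s" "\<delta> \<le> f t"
    using lower by auto
  then have pos: "0 < f s" "0 < f t"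
    using \<open>0 < \<delta>\<close> by auto
  have "inverse (f t) - inverse (f s) = (f s - f t) / (f t * f s)"
    using pos by (simp add: field_simps)
  then have "norm (inverse (f t) - inverse (f s)) = \<bar>f t - f s\<bar> / (f t * f s)"
    using pos by (simp add: abs_minus_commute)
  also have "\<dots> \<le> \<bar>f t - f s\<bar> / \<delta>\<^sup>2"
    using st pos \<open>0 < \<delta>\<close> by (intro divide_left_mono) (auto simp: power2_eq_square intro!: mult_mono)
  finally show "norm (inverse (f t) - inverse (f s)) \<le> 1 / \<delta>\<^sup>2 * norm (f t - f s)"
    by simp
qed

lemma arsinh_lipschitz:
  fixes x y :: real
  shows "\<bar>arsinh y - arsinh x\<bar> \<le> \<bar>y - x\<bar>"
proof -
  have "norm (arsinh y - arsinh x) \<le> 1 * norm (y - x)"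
  proof (rule field_differentiable_bound[of UNIV arsinh "\<lambda>x. 1 / sqrt (x\<^sup>2 + 1)"])
    show "(arsinh has_field_derivative 1 / sqrt (z\<^sup>2 + 1)) (at z within UNIV)" for z :: real
      by (rule arsinh_real_has_field_derivative)
    show "norm (1 / sqrt (z\<^sup>2 + 1)) \<le> 1" for z :: real
    proof -
      have "1 \<le> sqrt (z\<^sup>2 + 1)"
        by simp
      then have "1 / sqrt (z\<^sup>2 + 1) \<le> 1"
        by (subst divide_le_eq_1) linarith
      then show ?thesis by simp
    qed
  qed auto
  then show ?thesis by simp
qed

lemma abs_cont_on_arsinh:
  assumes "abs_cont_on a b f"
  shows "abs_cont_on a b (\<lambda>t. arsinh (f t :: real))"
  by (rule abs_cont_on_compose_lipschitz[OF assms, where L = 1]) (simp add: arsinh_lipschitz)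

lemma abs_cont_on_C1:
  fixes f :: "real \<Rightarrow> 'a::real_normed_vector"
  assumes deriv: "\<And>t. t \<in> {a..b} \<Longrightarrow> (f has_vector_derivative f' t) (at t within {a..b})"
    and cont: "continuous_on {a..b} f'"
  shows "abs_cont_on a b f"
proof -
  have "bounded (f' ` {a..b})"
    using cont by (intro compact_imp_bounded compact_continuous_image) auto
  then obtain B where B: "\<And>t. t \<in> {a..b} \<Longrightarrow> norm (f' t) \<le> B"
    unfolding bounded_iff by blast
  show ?thesis
  proof (rule abs_cont_on_lipschitz)
    fix s t assume st: "a \<le> s" "s \<le> t" "t \<le> b"
    have "norm (f t - f s) \<le> B * norm (t - s)"
    proof (rule differentiable_bound)
      show "(f has_derivative (\<lambda>h. h *\<^sub>R f' r)) (at r within {a..b})" if "r \<in> {a..b}" for r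
        using deriv[OF that] by (simp add: has_vector_derivative_def)
      show "onorm (\<lambda>h. h *\<^sub>R f' r) \<le> B" if "r \<in> {a..b}" for r
        using B[OF that] by (intro onorm_le) (simp add: mult_right_mono mult.commute[of B] mult_left_mono)
    qed (use st in auto)
    then show "norm (f t - f s) \<le> B * (t - s)"
      using st by simp
  qed
qed

lemma positive_lower_bound:
  fixes f :: "real \<Rightarrow> real"
  assumes "abs_cont_on a b f" "\<And>t. t \<in> {a..b} \<Longrightarrow> 0 < f t"
  obtains \<delta> where "0 < \<delta>" "\<And>t. t \<in> {a..b} \<Longrightarrow> \<delta> \<le> f t"
proof (cases "{a..b} = {}")
  case True
  then show ?thesis
    using that[of 1] by auto
next
  case False
  then obtain s where "s \<in> {a..b}" "\<And>t. t \<in> {a..b} \<Longrightarrow> f s \<le> f t"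
    using continuous_attains_inf[OF compact_Icc False abs_cont_on_continuous[OF assms(1)]] by blast
  then show ?thesis
    using that[of "f s"] assms(2) by blast
qed

section \<open>Exceptional slopes of an absolutely continuous function\<close>

text \<open>Vitali's covering theorem in the form used for derivatives. The countable disjoint family that it
  provides has finite total length inside \<open>U\<close>, so finitely many of its members already cover
  \<open>E\<close> up to a set \<open>T\<close> of small measure. Formulating the conclusion with an explicit remainder
  \<open>T\<close> makes it meaningful for sets \<open>E\<close> that are not known to be measurable.\<close>

lemma finite_Vitali_intervals:
  fixes E U :: "real set"
  assumes U: "open U" "U \<in> lmeasurable" "E \<subseteq> U" and "0 < e"
    and fine: "\<And>x d. \<lbrakk>x \<in> E; 0 < d\<rbrakk> \<Longrightarrow> \<exists>u v. P u v \<and> u < v \<and> x \<in> {u..v} \<and> v - u < d"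
  obtains D T where "D division_of \<Union>D" "\<Union>D \<subseteq> U"
    "\<And>k. k \<in> D \<Longrightarrow> \<exists>u v. P u v \<and> u < v \<and> k = {u..v}"
    "E \<subseteq> \<Union>D \<union> T" "T \<in> lmeasurable" "measure lebesgue T < e"
proof -
  define K where "K = {(u,v). P u v \<and> u < v \<and> {u..v} \<subseteq> U}"
  define mid :: "real \<times> real \<Rightarrow> real" where "mid = (\<lambda>(u,v). (u + v) / 2)"
  define rad :: "real \<times> real \<Rightarrow> real" where "rad = (\<lambda>(u,v). (v - u) / 2)"
  have cball: "cball (mid k) (rad k) = {fst k..snd k}" for k
    by (auto simp: mid_def rad_def cball_eq_atLeastAtMost field_simps split: prod.splits)
  obtain C where C: "countable C" "C \<subseteq> K"
     and disj: "pairwise (\<lambda>i j. disjnt (cball (mid i) (rad i)) (cball (mid j) (rad j))) C"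
     and neg: "negligible (E - (\<Union>i\<in>C. cball (mid i) (rad i)))"
  proof (rule Vitali_covering_theorem_cballs[of K rad E mid])
    show "0 < rad i" if "i \<in> K" for i
      using that by (auto simp: K_def rad_def)
    show "\<exists>i. i \<in> K \<and> x \<in> cball (mid i) (rad i) \<and> rad i < d" if "x \<in> E" "0 < d" for x d
    proof -
      obtain r where r: "0 < r" "ball x r \<subseteq> U"
        using U \<open>x \<in> E\<close> by (meson open_contains_ball subsetD)
      obtain u v where uv: "P u v" "u < v" "x \<in> {u..v}" "v - u < min d r"
        using fine[OF \<open>x \<in> E\<close>, of "min d r"] r \<open>0 < d\<close> by auto
      have "{u..v} \<subseteq> ball x r"
        using uv by (auto simp: dist_real_def)
      moreover have "x \<in> cball (mid (u,v)) (rad (u,v))"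
        unfolding cball using uv(3) by simp
      ultimately show ?thesis
        using uv r by (intro exI[of _ "(u,v)"]) (auto simp: K_def cball rad_def simp del: mem_cball)
    qed
  qed
  define \<C> where "\<C> = (\<lambda>k. {fst k..snd k}) ` C"
  have "countable \<C>"
    using C by (simp add: \<C>_def)
  have cell: "\<exists>u v. P u v \<and> u < v \<and> k = {u..v}" and sub: "k \<subseteq> U" if "k \<in> \<C>" for k
    using that C(2) unfolding \<C>_def K_def by fastforce+
  have dis: "k \<inter> l = {}" if "k \<in> \<C>" "l \<in> \<C>" "k \<noteq> l" for k l
  proof -
    obtain i j where "i \<in> C" "j \<in> C" "k = {fst i..snd i}" "l = {fst j..snd j}" "i \<noteq> j"
      using \<open>k \<in> \<C>\<close> \<open>l \<in> \<C>\<close> \<open>k \<noteq> l\<close> unfolding \<C>_def by fastforce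
    then show ?thesis
      using pairwiseD[OF disj, of i j] unfolding cball disjnt_def by simp
  qed
  have meas: "k \<in> lmeasurable" if "k \<in> \<C>" for k
    using cell[OF that] by auto
  define B where "B = Sup ((\<lambda>F. measure lebesgue (\<Union>F)) ` {F. finite F \<and> F \<subseteq> \<C>})"
  have bdd: "bdd_above ((\<lambda>F. measure lebesgue (\<Union>F)) ` {F. finite F \<and> F \<subseteq> \<C>})"
  proof (rule bdd_aboveI2[where M = "measure lebesgue U"])
    fix F assume "F \<in> {F. finite F \<and> F \<subseteq> \<C>}"
    then show "measure lebesgue (\<Union>F) \<le> measure lebesgue U"
      using U sub meas by (intro measure_mono_fmeasurable) (auto intro!: sets.finite_Union)
  qed
  have "B - e < B"
    using \<open>0 < e\<close> by simp
  then obtain F where F: "finite F" "F \<subseteq> \<C>" "B - e < measure lebesgue (\<Union>F)"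
    unfolding B_def by (subst (asm) less_cSup_iff) (use bdd in auto)
  \<comment> \<open>\<open>F\<close> almost exhausts the supremum of the measures of finite unions, so whatever finite union is
      added to it contributes less than \<open>e\<close>.\<close>
  define T where "T = \<Union>(\<C> - F) \<union> (E - (\<Union>i\<in>C. cball (mid i) (rad i)))"
  have rest: "measure lebesgue (\<Union>G) \<le> B - measure lebesgue (\<Union>F)" if G: "G \<subseteq> \<C> - F" "finite G" for G
  proof -
    have "measure lebesgue (\<Union>(F \<union> G)) \<le> B"
      unfolding B_def using F G bdd by (intro cSUP_upper) auto
    moreover have "measure lebesgue (\<Union>F \<union> \<Union>G) = measure lebesgue (\<Union>F) + measure lebesgue (\<Union>G)"
      using F G meas dis
      by (intro measure_Un_AE fmeasurable.finite_Union AE_I2) (auto, blast)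
    ultimately show ?thesis
      by (simp add: Union_Un_distrib)
  qed
  have T1: "\<Union>(\<C> - F) \<in> lmeasurable" "measure lebesgue (\<Union>(\<C> - F)) \<le> B - measure lebesgue (\<Union>F)"
  proof -
    have "countable (\<C> - F)" "\<And>k. k \<in> \<C> - F \<Longrightarrow> k \<in> lmeasurable"
      using \<open>countable \<C>\<close> meas by auto
    from fmeasurable_Union_bound[OF this rest] measure_Union_bound[OF this rest]
    show "\<Union>(\<C> - F) \<in> lmeasurable" "measure lebesgue (\<Union>(\<C> - F)) \<le> B - measure lebesgue (\<Union>F)"
      by simp_all
  qed
  have T: "T \<in> lmeasurable" "measure lebesgue T < e"
  proof -
    show "T \<in> lmeasurable"
      unfolding T_def using T1(1) negligible_imp_measurable[OF neg] by blast
    have "measure lebesgue T \<le> measure lebesgue (\<Union>(\<C> - F)) + measure lebesgue (E - (\<Union>i\<in>C. cball (mid i) (rad i)))"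
      unfolding T_def using T1(1) negligible_imp_measurable[OF neg] by (intro measure_Un_le) auto
    also have "\<dots> < e"
      using T1(2) F(3) negligible_imp_measure0[OF neg] by simp
    finally show "measure lebesgue T < e" .
  qed
  have div: "F division_of \<Union>F"
  proof (rule division_ofI)
    show "interior k \<inter> interior l = {}" if "k \<in> F" "l \<in> F" "k \<noteq> l" for k l
      using dis[of k l] that F(2) interior_subset by blast
    show "\<exists>a b. k = cbox a b" "k \<noteq> {}" if "k \<in> F" for k
      using cell[of k] that F(2) by fastforce+
  qed (use F in auto)
  have "E \<subseteq> \<Union>F \<union> T"
    by (auto simp: T_def \<C>_def cball)
  then show ?thesis
    using that[OF div _ _ _ T] sub cell F(2) by blast
qed

text \<open>If \<open>S2\<close> fills \<open>S1\<close> up to measure \<open>\<delta>\<close>, the total increments over the two families nearly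
  agree. Indeed, let \<open>J\<close> consist of the cells that complete \<open>D1\<close> to a division of \<open>[a, b]\<close>, and
  \<open>G\<close> of those that complete \<open>D2 \<union> J\<close>. Telescoping over both divisions of \<open>[a, b]\<close> shows that the
  increments over \<open>D1\<close> and over \<open>D2\<close> differ by those over \<open>G\<close>, and the total length of \<open>G\<close> is
  below \<open>\<delta>\<close>. This replaces the monotonicity used in the classical proof of Lebesgue's
  differentiation theorem.\<close>

lemma nested_divisions_increments:
  fixes f :: "real \<Rightarrow> real"
  assumes ab: "a \<le> b"
    and \<delta>: "\<And>D S. D division_of S \<Longrightarrow> S \<subseteq> {a..b} \<Longrightarrow> (\<Sum>k\<in>D. Sup k - Inf k) < \<delta>
        \<Longrightarrow> (\<Sum>k\<in>D. norm (f (Sup k) - f (Inf k))) < \<epsilon>"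
    and D1: "D1 division_of S1" "S1 \<subseteq> {a..b}" and D2: "D2 division_of S2" "S2 \<subseteq> S1"
    and close: "measure lebesgue S1 - measure lebesgue S2 < \<delta>"
  shows "\<bar>(\<Sum>k\<in>D1. f (Sup k) - f (Inf k)) - (\<Sum>k\<in>D2. f (Sup k) - f (Inf k))\<bar> < \<epsilon>"
proof -
  obtain I where I: "D1 \<subseteq> I" "I division_of {a..b}"
    using partial_division_extend_interval[of D1 a b] D1 by (metis box_real(2) division_of_def)
  define J where "J = I - D1"
  have J: "J division_of \<Union>J" and JI: "\<Union>J \<subseteq> {a..b}"
    using division_of_subset[of I J] I(2) division_ofD(6)[OF I(2)] by (auto simp: J_def)
  have int: "interior k \<inter> interior l = {}" if "k \<in> D2" "l \<in> J" for k l
  proof -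
    have "interior l \<inter> interior (\<Union>D1) = {}"
    proof (rule Int_interior_Union_intervals)
      show "interior l \<inter> interior T = {}" if "T \<in> D1" for T
        using division_ofD(5)[OF I(2), of l T] that \<open>l \<in> J\<close> I(1) by (auto simp: J_def)
    qed (use division_ofD[OF D1(1)] in auto)
    moreover have "k \<subseteq> \<Union>D1"
      using division_ofD(2)[OF D2(1) that(1)] D2(2) division_ofD(6)[OF D1(1)] by auto
    ultimately show ?thesis
      using interior_mono by blast
  qed
  have "D2 \<union> J division_of S2 \<union> \<Union>J"
  proof (rule division_ofI)
    show "finite (D2 \<union> J)"
      using D2 J by auto
    show "\<Union>(D2 \<union> J) = S2 \<union> \<Union>J"
      using division_ofD(6)[OF D2(1)] by auto
    show "interior k \<inter> interior l = {}" if "k \<in> D2 \<union> J" "l \<in> D2 \<union> J" "k \<noteq> l" for k l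
      using that int[of k l] int[of l k] division_ofD(5)[OF D2(1), of k l] division_ofD(5)[OF J, of k l]
      by (auto simp: Int_commute)
    show "k \<subseteq> S2 \<union> \<Union>J" "k \<noteq> {}" "\<exists>a b. k = cbox a b" if "k \<in> D2 \<union> J" for k
      using that division_ofD(2,3,4)[OF D2(1), of k] division_ofD(2,3,4)[OF J, of k] by auto
  qed
  then have "D2 \<union> J division_of \<Union>(D2 \<union> J)" "\<Union>(D2 \<union> J) \<subseteq> {a..b}"
  proof -
    have eq: "\<Union>(D2 \<union> J) = S2 \<union> \<Union>J"
      using division_ofD(6)[OF D2(1)] by auto
    show "D2 \<union> J division_of \<Union>(D2 \<union> J)"
      using \<open>D2 \<union> J division_of S2 \<union> \<Union>J\<close> unfolding eq .
    show "\<Union>(D2 \<union> J) \<subseteq> {a..b}"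
      unfolding eq using D1(2) D2(2) JI by blast
  qed
  then obtain r where r: "D2 \<union> J \<subseteq> r" "r division_of {a..b}"
    using partial_division_extend_interval[of "D2 \<union> J" a b] by (metis box_real(2))
  define G where "G = r - (D2 \<union> J)"
  have G: "G division_of \<Union>G" "\<Union>G \<subseteq> {a..b}"
    using division_of_subset[of r G] r(2) division_ofD(6)[OF r(2)] by (auto simp: G_def)
  have fin: "finite D1" "finite D2" "finite J" "finite G"
    using D1 D2 J G by auto
  have split: "(\<Sum>k\<in>D1. g (Sup k) - g (Inf k)) = (\<Sum>k\<in>D2. g (Sup k) - g (Inf k)) + (\<Sum>k\<in>G. g (Sup k) - g (Inf k))"
    for g :: "real \<Rightarrow> real"
  proof -
    let ?g = "\<lambda>k. g (Sup k) - g (Inf k)"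
    \<comment> \<open>A cell in both families can only be a single point, and contributes nothing.\<close>
    have deg: "?g k = 0" if "k \<in> D2 \<inter> J" for k
    proof -
      have "interior k = {}"
        using int[of k k] that by auto
      then have "Inf k = Sup k"
        using division_cell_real[OF D2(1), of k] that
        by (metis IntD1 interior_atLeastAtMost_real greaterThanLessThan_empty_iff order_antisym)
      then show ?thesis by simp
    qed
    have "sum ?g D1 + sum ?g J = sum ?g I"
      using I(1) fin by (subst sum.union_disjoint[symmetric]) (auto simp: J_def Un_absorb1)
    also have "\<dots> = sum ?g r"
      using sum_increments_division[OF ab I(2), of g] sum_increments_division[OF ab r(2), of g] by simp
    also have "\<dots> = sum ?g (D2 \<union> J) + sum ?g G"
      using r(1) fin by (subst sum.union_disjoint[symmetric]) (auto simp: G_def Un_absorb1)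
    also have "sum ?g (D2 \<union> J) = sum ?g D2 + sum ?g J"
      using fin deg by (intro sum.union_inter_neutral) auto
    finally show ?thesis by simp
  qed
  have "(\<Sum>k\<in>G. Sup k - Inf k) < \<delta>"
    using split[of "\<lambda>x. x"] close sum_lengths_eq_measure[OF D1(1)] sum_lengths_eq_measure[OF D2(1)] by simp
  then have "(\<Sum>k\<in>G. norm (f (Sup k) - f (Inf k))) < \<epsilon>"
    by (rule \<delta>[OF G])
  then show ?thesis
    using split[of f] sum_abs[of "\<lambda>k. f (Sup k) - f (Inf k)" G] by (simp only: real_norm_def)
qed

text \<open>Turns a condition on difference quotients with base point \<open>x\<close> into arbitrarily short intervals
  containing \<open>x\<close>, as needed for the Vitali covering.\<close>

lemma Vitali_interval_slope:
  fixes f :: "real \<Rightarrow> real"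
  assumes "\<exists>\<^sub>F y in at x. P ((f y - f x) / (y - x))" "0 < d"
  shows "\<exists>u v. P ((f v - f u) / (v - u)) \<and> u < v \<and> x \<in> {u..v} \<and> v - u < d"
proof -
  have "\<forall>\<^sub>F y in at x. dist y x < d \<and> y \<noteq> x"
    using assms(2) by (auto simp: eventually_at)
  then obtain y where y: "P ((f y - f x) / (y - x))" "dist y x < d" "y \<noteq> x"
    using frequently_eventually_frequently[OF assms(1)] frequently_ex by blast
  show ?thesis
  proof (cases "x < y")
    case True
    then show ?thesis
      using y by (intro exI[of _ x] exI[of _ y]) (auto simp: dist_real_def)
  next
    case False
    moreover have "(f y - f x) / (y - x) = (f x - f y) / (x - y)"
      by (metis minus_diff_eq minus_divide_divide)
    ultimately show ?thesis
      using y by (intro exI[of _ y] exI[of _ x]) (auto simp: dist_real_def)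
  qed
qed

lemma lmeasurable_outer_open:
  fixes S :: "'a::euclidean_space set"
  assumes "S \<in> lmeasurable" "0 < e"
  obtains T where "open T" "S \<subseteq> T" "T \<in> lmeasurable" "measure lebesgue T < measure lebesgue S + e"
proof -
  obtain T where T: "open T" "S \<subseteq> T" "T - S \<in> lmeasurable" "emeasure lebesgue (T - S) < ennreal e"
    using sets_lebesgue_outer_open[of S e] assms by (metis fmeasurableD)
  have "S \<union> (T - S) = T"
    using T(2) by blast
  then have "T \<in> lmeasurable" "measure lebesgue T \<le> measure lebesgue S + measure lebesgue (T - S)"
    using fmeasurable.Un[OF assms(1) T(3)] measure_Un_le[of S lebesgue "T - S"] assms(1) T(3)
    by (auto dest: fmeasurableD)
  moreover have "measure lebesgue (T - S) < e"
    using T(3,4) assms(2) by (simp add: emeasure_eq_measure2 ennreal_less_iff)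
  ultimately show ?thesis
    using that[OF T(1,2)] by linarith
qed

text \<open>Let \<open>\<alpha>\<close> be the outer measure of the set \<open>E\<close> of points with slopes both at most \<open>p\<close> and
  at least \<open>q\<close>. Cover \<open>E\<close> by short intervals of slope at most \<open>p\<close> inside an open set of measure close to
  \<open>\<alpha>\<close>, and then, inside these, by intervals of slope at least \<open>q\<close>. Both unions have measure
  close to \<open>\<alpha>\<close>, so by absolute continuity the total increments over them nearly agree; but one is
  at most about \<open>p * \<alpha>\<close> and the other at least about \<open>q * \<alpha>\<close>. Hence \<open>\<alpha> = 0\<close>.\<close>

lemma negligible_two_slopes:
  fixes f :: "real \<Rightarrow> real"
  assumes f: "abs_cont_on a b f" and "p < q"
  shows "negligible {x \<in> {a<..<b}. (\<exists>\<^sub>F y in at x. (f y - f x) / (y - x) \<le> p) \<and>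
                                     (\<exists>\<^sub>F y in at x. q \<le> (f y - f x) / (y - x))}" (is "negligible ?E")
proof -
  define \<G> where "\<G> = {G \<in> lmeasurable. ?E \<subseteq> G}"
  define \<alpha> where "\<alpha> = Inf (measure lebesgue ` \<G>)"
  have "{a<..<b} \<in> \<G>"
    by (auto simp: \<G>_def)
  then have ne: "measure lebesgue ` \<G> \<noteq> {}"
    by blast
  have bdd: "bdd_below (measure lebesgue ` \<G>)"
    by (auto intro!: bdd_belowI[of _ 0])
  have \<alpha>_le: "\<alpha> \<le> measure lebesgue G" if "G \<in> lmeasurable" "?E \<subseteq> G" for G
    unfolding \<alpha>_def using that by (intro cInf_lower bdd) (auto simp: \<G>_def)
  have key: "\<alpha> \<le> ((4 * \<bar>p\<bar> + 1) / (q - p) + 2) * \<eta>" if "0 < \<eta>" for \<eta>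
  proof (cases "a \<le> b")
    case False
    then have "\<alpha> \<le> 0"
      using \<alpha>_le[of "{}"] by auto
    then show ?thesis
    proof (rule order_trans)
      show "0 \<le> ((4 * \<bar>p\<bar> + 1) / (q - p) + 2) * \<eta>"
        using that \<open>p < q\<close> by simp
    qed
  next
    case True
    obtain \<delta> where "0 < \<delta>" and \<delta>: "\<And>D S. D division_of S \<Longrightarrow> S \<subseteq> {a..b} \<Longrightarrow> (\<Sum>k\<in>D. Sup k - Inf k) < \<delta>
        \<Longrightarrow> (\<Sum>k\<in>D. norm (f (Sup k) - f (Inf k))) < \<eta>"
      using abs_cont_onD[OF f \<open>0 < \<eta>\<close>] by metis
    \<comment> \<open>Four errors of size \<open>\<epsilon>\<close> separate the two unions: twice in choosing the open set \<open>U\<close>, and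
        once for each of the two Vitali remainders.\<close>
    define \<epsilon> where "\<epsilon> = min \<eta> (\<delta> / 4)"
    have \<epsilon>: "0 < \<epsilon>" "\<epsilon> \<le> \<eta>" "4 * \<epsilon> \<le> \<delta>"
      using \<open>0 < \<delta>\<close> \<open>0 < \<eta>\<close> by (auto simp: \<epsilon>_def)
    obtain G where G: "G \<in> lmeasurable" "?E \<subseteq> G" "measure lebesgue G < \<alpha> + \<epsilon>"
      using cInf_lessD[OF ne, of "\<alpha> + \<epsilon>"] \<epsilon>(1) unfolding \<alpha>_def[symmetric] by (auto simp: \<G>_def)
    obtain V where V: "open V" "G \<subseteq> V" "V \<in> lmeasurable" "measure lebesgue V < measure lebesgue G + \<epsilon>"
      using lmeasurable_outer_open[OF G(1) \<epsilon>(1)] by metis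
    define U where "U = V \<inter> {a<..<b}"
    have U: "open U" "U \<in> lmeasurable" "?E \<subseteq> U" "U \<subseteq> {a..b}"
      using V G by (auto simp: U_def fmeasurable.Int)
    have "measure lebesgue U \<le> measure lebesgue V"
      using V U by (intro measure_mono_fmeasurable) (auto simp: U_def)
    then have U\<alpha>: "measure lebesgue U < \<alpha> + 2 * \<epsilon>"
      using V G by linarith
    have fine1: "\<exists>u v. (f v - f u) / (v - u) \<le> p \<and> u < v \<and> x \<in> {u..v} \<and> v - u < d"
      if "x \<in> ?E" "0 < d" for x d
      using that by (intro Vitali_interval_slope[where P = "\<lambda>s. s \<le> p"]) auto
    obtain D1 T1 where D1: "D1 division_of \<Union>D1" "\<Union>D1 \<subseteq> U"
        "\<And>k. k \<in> D1 \<Longrightarrow> \<exists>u v. (f v - f u) / (v - u) \<le> p \<and> u < v \<and> k = {u..v}"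
      and T1: "?E \<subseteq> \<Union>D1 \<union> T1" "T1 \<in> lmeasurable" "measure lebesgue T1 < \<epsilon>"
      by (rule finite_Vitali_intervals[OF U(1-3) \<epsilon>(1) fine1]) (assumption, assumption, (rule that; (assumption | blast)))
    define W where "W = interior (\<Union>D1)"
    have W: "open W" "W \<in> lmeasurable" "W \<subseteq> \<Union>D1"
    proof -
      show "open W" and sub: "W \<subseteq> \<Union>D1"
        by (auto simp: W_def interior_subset)
      have "bounded W"
        using sub D1(2) U(4) bounded_subset[OF bounded_closed_interval[of a b]] by blast
      then show "W \<in> lmeasurable"
        using \<open>open W\<close> by (intro lmeasurable_open)
    qed
    have fine2: "\<exists>u v. q \<le> (f v - f u) / (v - u) \<and> u < v \<and> x \<in> {u..v} \<and> v - u < d"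
      if "x \<in> ?E \<inter> W" "0 < d" for x d
      using that by (intro Vitali_interval_slope[where P = "\<lambda>s. q \<le> s"]) auto
    obtain D2 T2 where D2: "D2 division_of \<Union>D2" "\<Union>D2 \<subseteq> W"
        "\<And>k. k \<in> D2 \<Longrightarrow> \<exists>u v. q \<le> (f v - f u) / (v - u) \<and> u < v \<and> k = {u..v}"
      and T2: "?E \<inter> W \<subseteq> \<Union>D2 \<union> T2" "T2 \<in> lmeasurable" "measure lebesgue T2 < \<epsilon>"
      by (rule finite_Vitali_intervals[OF W(1,2) Int_lower2 \<epsilon>(1) fine2]) (assumption, assumption, (rule that; (assumption | blast)))
    have fin: "finite D1" "finite D2"
      using D1 D2 by (auto dest: division_ofD)
    \<comment> \<open>Only the endpoints of the cells of \<open>D1\<close> are lost when passing to the interior.\<close>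
    define Z where "Z = Inf ` D1 \<union> Sup ` D1"
    have "\<Union>D1 \<subseteq> W \<union> Z"
    proof
      fix x assume "x \<in> \<Union>D1"
      then obtain k where k: "k \<in> D1" "x \<in> k"
        by blast
      obtain u v where uv: "u < v" "k = {u..v}"
        using D1(3)[OF k(1)] by blast
      have "{u<..<v} \<subseteq> W"
      proof -
        have "{u<..<v} \<subseteq> \<Union>D1"
          using k(1) uv(2) greaterThanLessThan_subseteq_atLeastAtMost_iff by blast
        then show ?thesis
          unfolding W_def by (intro interior_maximal) auto
      qed
      moreover have "u \<in> Z" "v \<in> Z"
      proof -
        have "Inf k = u" "Sup k = v"
          using uv by auto
        then show "u \<in> Z" "v \<in> Z"
          unfolding Z_def using k(1) by blast+
      qed
      moreover have "x = u \<or> x = v \<or> x \<in> {u<..<v}"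
        using k(2) uv(2) by auto
      ultimately show "x \<in> W \<union> Z"
        by blast
    qed
    then have cover: "?E \<subseteq> \<Union>D2 \<union> (T1 \<union> T2 \<union> Z)"
      using T1(1) T2(1) by blast
    have Z: "negligible Z"
      using fin by (intro negligible_finite) (auto simp: Z_def)
    have mD: "\<Union>D1 \<in> lmeasurable" "\<Union>D2 \<in> lmeasurable"
      using D1(1) D2(1) lmeasurable_division by blast+
    have "\<alpha> \<le> measure lebesgue (\<Union>D2 \<union> (T1 \<union> T2 \<union> Z))"
      using cover mD T1 T2 negligible_imp_measurable[OF Z] by (intro \<alpha>_le) auto
    also have "\<dots> \<le> measure lebesgue (\<Union>D2) + (measure lebesgue T1 + measure lebesgue T2 + measure lebesgue Z)"
      using mD T1 T2 negligible_imp_measurable[OF Z]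
      by (intro order_trans[OF measure_Un_le] add_mono order_refl) auto
    finally have \<alpha>2: "\<alpha> \<le> measure lebesgue (\<Union>D2) + 2 * \<epsilon>"
      using T1 T2 negligible_imp_measure0[OF Z] by linarith
    have "measure lebesgue (\<Union>D1) \<le> measure lebesgue U"
      using D1(2) U(2) mD by (intro measure_mono_fmeasurable) auto
    then have gap: "measure lebesgue (\<Union>D1) - measure lebesgue (\<Union>D2) < 4 * \<epsilon>"
      using U\<alpha> \<alpha>2 by linarith
    have "measure lebesgue (\<Union>D2) \<le> measure lebesgue (\<Union>D1)"
      using D2(2) W(3) mD by (intro measure_mono_fmeasurable) auto
    then have gap': "\<bar>measure lebesgue (\<Union>D1) - measure lebesgue (\<Union>D2)\<bar> \<le> 4 * \<eta>"
      using gap \<epsilon>(2) by linarith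
    have "(\<Sum>k\<in>D1. f (Sup k) - f (Inf k)) \<le> (\<Sum>k\<in>D1. p * (Sup k - Inf k))"
      using D1(3) by (intro sum_mono) (fastforce simp: divide_le_eq)
    moreover have "(\<Sum>k\<in>D2. q * (Sup k - Inf k)) \<le> (\<Sum>k\<in>D2. f (Sup k) - f (Inf k))"
      using D2(3) by (intro sum_mono) (fastforce simp: le_divide_eq)
    moreover have "\<bar>(\<Sum>k\<in>D1. f (Sup k) - f (Inf k)) - (\<Sum>k\<in>D2. f (Sup k) - f (Inf k))\<bar> < \<eta>"
    proof -
      have "\<Union>D1 \<subseteq> {a..b}" "\<Union>D2 \<subseteq> \<Union>D1"
        using D1(2) U(4) D2(2) W(3) by blast+
      moreover have "measure lebesgue (\<Union>D1) - measure lebesgue (\<Union>D2) < \<delta>"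
        using gap \<epsilon>(3) by linarith
      ultimately show ?thesis
        by (intro nested_divisions_increments[OF True _ D1(1) _ D2(1)]) (rule \<delta>; assumption)
    qed
    ultimately have "q * measure lebesgue (\<Union>D2) \<le> p * measure lebesgue (\<Union>D1) + \<eta>"
      unfolding sum_distrib_left[symmetric] sum_lengths_eq_measure[OF D1(1)] sum_lengths_eq_measure[OF D2(1)]
      by linarith
    then have "(q - p) * measure lebesgue (\<Union>D2) \<le> p * (measure lebesgue (\<Union>D1) - measure lebesgue (\<Union>D2)) + \<eta>"
      by (simp add: algebra_simps)
    also have "\<dots> \<le> \<bar>p\<bar> * (4 * \<eta>) + \<eta>"
    proof -
      have "p * (measure lebesgue (\<Union>D1) - measure lebesgue (\<Union>D2))
          \<le> \<bar>p\<bar> * \<bar>measure lebesgue (\<Union>D1) - measure lebesgue (\<Union>D2)\<bar>"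
        unfolding abs_mult[symmetric] by (rule abs_ge_self)
      also have "\<dots> \<le> \<bar>p\<bar> * (4 * \<eta>)"
        using gap' by (intro mult_left_mono) auto
      finally show ?thesis by simp
    qed
    also have "\<dots> = (4 * \<bar>p\<bar> + 1) * \<eta>"
      by (simp add: algebra_simps)
    finally have "measure lebesgue (\<Union>D2) \<le> (4 * \<bar>p\<bar> + 1) * \<eta> / (q - p)"
      using \<open>p < q\<close> by (simp add: pos_le_divide_eq mult.commute)
    then show ?thesis
      using \<alpha>2 \<epsilon>(2) by (simp add: algebra_simps)
  qed
  have "\<alpha> \<le> 0"
  proof (rule field_le_epsilon)
    fix e :: real assume "0 < e"
    define c where "c = (4 * \<bar>p\<bar> + 1) / (q - p) + 2"
    have "0 < c"
      unfolding c_def using \<open>p < q\<close> by (intro add_nonneg_pos divide_nonneg_pos) auto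
    then show "\<alpha> \<le> 0 + e"
      using key[of "e / c"] \<open>0 < e\<close> by (simp add: c_def[symmetric])
  qed
  show ?thesis
    unfolding negligible_outer
  proof (intro allI impI)
    fix e :: real assume "0 < e"
    then show "\<exists>T. ?E \<subseteq> T \<and> T \<in> lmeasurable \<and> measure lebesgue T < e"
      using cInf_lessD[OF ne, of e] \<open>\<alpha> \<le> 0\<close> unfolding \<alpha>_def[symmetric] by (auto simp: \<G>_def)
  qed
qed

text \<open>On an interval shorter than the \<open>\<delta>\<close> belonging to \<open>\<epsilon> = 1\<close>, disjoint intervals of slope at least
  \<open>q\<close> in absolute value have total length at most \<open>1 / q\<close>. This covers the whole
  interval, because being negligible is a local property.\<close>

lemma negligible_unbounded_slopes:
  fixes f :: "real \<Rightarrow> real"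
  assumes f: "abs_cont_on a b f"
  shows "negligible {x \<in> {a<..<b}. \<forall>q. \<exists>\<^sub>F y in at x. q \<le> \<bar>(f y - f x) / (y - x)\<bar>}" (is "negligible ?E")
proof -
  obtain \<delta> where "0 < \<delta>" and \<delta>: "\<And>D S. D division_of S \<Longrightarrow> S \<subseteq> {a..b} \<Longrightarrow> (\<Sum>k\<in>D. Sup k - Inf k) < \<delta>
        \<Longrightarrow> (\<Sum>k\<in>D. norm (f (Sup k) - f (Inf k))) < 1"
    using abs_cont_onD[OF f zero_less_one] by metis
  have local_null: "negligible (?E \<inter> {z - \<delta> / 4<..<z + \<delta> / 4})" for z
    unfolding negligible_outer
  proof (intro allI impI)
    fix e :: real assume "0 < e"
    define U where "U = {a<..<b} \<inter> {z - \<delta> / 4<..<z + \<delta> / 4}"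
    have U: "open U" "U \<in> lmeasurable" "?E \<inter> {z - \<delta> / 4<..<z + \<delta> / 4} \<subseteq> U" "U \<subseteq> {a..b}"
      by (auto simp: U_def fmeasurable.Int)
    have "0 < e / 2"
      using \<open>0 < e\<close> by simp
    have fine: "\<exists>u v. 2 / e \<le> \<bar>(f v - f u) / (v - u)\<bar> \<and> u < v \<and> x \<in> {u..v} \<and> v - u < d"
      if "x \<in> ?E \<inter> {z - \<delta> / 4<..<z + \<delta> / 4}" "0 < d" for x d
      using that by (intro Vitali_interval_slope[where P = "\<lambda>s. 2 / e \<le> \<bar>s\<bar>"]) auto
    obtain D T where D: "D division_of \<Union>D" "\<Union>D \<subseteq> U"
        "\<And>k. k \<in> D \<Longrightarrow> \<exists>u v. 2 / e \<le> \<bar>(f v - f u) / (v - u)\<bar> \<and> u < v \<and> k = {u..v}"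
      and T: "?E \<inter> {z - \<delta> / 4<..<z + \<delta> / 4} \<subseteq> \<Union>D \<union> T" "T \<in> lmeasurable" "measure lebesgue T < e / 2"
      by (rule finite_Vitali_intervals[OF U(1-3) \<open>0 < e / 2\<close> fine]) (assumption, assumption, (rule that; (assumption | blast)))
    have mD: "\<Union>D \<in> lmeasurable"
      using D(1) lmeasurable_division by blast
    have "measure lebesgue (\<Union>D) \<le> measure lebesgue {z - \<delta> / 4..z + \<delta> / 4}"
      using D(2) mD by (intro measure_mono_fmeasurable) (auto simp: U_def)
    then have "(\<Sum>k\<in>D. Sup k - Inf k) < \<delta>"
      unfolding sum_lengths_eq_measure[OF D(1)] using \<open>0 < \<delta>\<close> by simp
    then have "(\<Sum>k\<in>D. norm (f (Sup k) - f (Inf k))) < 1"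
      using D U by (intro \<delta>[OF D(1)]) auto
    moreover have "(\<Sum>k\<in>D. 2 / e * (Sup k - Inf k)) \<le> (\<Sum>k\<in>D. norm (f (Sup k) - f (Inf k)))"
    proof (rule sum_mono)
      fix k assume "k \<in> D"
      then obtain u v where uv: "2 / e \<le> \<bar>(f v - f u) / (v - u)\<bar>" "u < v" "k = {u..v}"
        using D(3) by blast
      then have "2 / e \<le> \<bar>f v - f u\<bar> / (v - u)"
        by (simp add: abs_divide)
      then show "2 / e * (Sup k - Inf k) \<le> norm (f (Sup k) - f (Inf k))"
        using uv by (simp add: pos_le_divide_eq)
    qed
    ultimately have "2 / e * measure lebesgue (\<Union>D) < 1"
      unfolding sum_distrib_left[symmetric] sum_lengths_eq_measure[OF D(1)] by linarith
    then have "measure lebesgue (\<Union>D) < e / 2"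
      using \<open>0 < e\<close> by (simp add: field_simps)
    moreover have "measure lebesgue (\<Union>D \<union> T) \<le> measure lebesgue (\<Union>D) + measure lebesgue T"
      using mD T by (intro measure_Un_le) auto
    ultimately have "measure lebesgue (\<Union>D \<union> T) < e"
      using T(3) by linarith
    then show "\<exists>T. ?E \<inter> {z - \<delta> / 4<..<z + \<delta> / 4} \<subseteq> T \<and> T \<in> lmeasurable \<and> measure lebesgue T < e"
      using T mD by (intro exI[of _ "\<Union>D \<union> T"]) auto
  qed
  show ?thesis
    unfolding locally_negligible_alt[of ?E]
  proof (intro ballI)
    fix x assume "x \<in> ?E"
    then have "x \<in> ?E \<inter> {x - \<delta> / 4<..<x + \<delta> / 4}"
      using \<open>0 < \<delta>\<close> by simp
    moreover have "openin (top_of_set ?E) (?E \<inter> {x - \<delta> / 4<..<x + \<delta> / 4})"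
      by (intro openin_open_Int open_greaterThanLessThan)
    ultimately show "\<exists>U. openin (top_of_set ?E) U \<and> x \<in> U \<and> negligible U"
      using local_null by blast
  qed
qed

section \<open>Derivatives of absolutely continuous curves\<close>

text \<open>Rational thresholds suffice to exclude a gap between lower and upper limit, which keeps the
  exceptional sets countable in number.\<close>

lemma tendsto_if_no_oscillation:
  fixes g :: "'b \<Rightarrow> real"
  assumes "F \<noteq> bot"
    and bounded: "\<exists>B. \<forall>\<^sub>F y in F. \<bar>g y\<bar> < B"
    and osc: "\<And>p q. \<lbrakk>p < q; p \<in> \<rat>; q \<in> \<rat>; \<exists>\<^sub>F y in F. g y \<le> p; \<exists>\<^sub>F y in F. q \<le> g y\<rbrakk> \<Longrightarrow> False"
  shows "\<exists>l. (g \<longlongrightarrow> l) F"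
proof -
  let ?h = "\<lambda>y. ereal (g y)"
  have "Limsup F ?h \<le> Liminf F ?h"
  proof (rule ccontr)
    assume "\<not> Limsup F ?h \<le> Liminf F ?h"
    then obtain p where p: "Liminf F ?h < ereal p" "ereal p < Limsup F ?h"
      using ereal_dense2[of "Liminf F ?h" "Limsup F ?h"] by (auto simp: not_le)
    then obtain q where q: "ereal p < ereal q" "ereal q < Limsup F ?h"
      using ereal_dense2[of "ereal p" "Limsup F ?h"] by auto
    obtain p' where p': "p' \<in> \<rat>" "p < p'" "p' < q"
      using Rats_dense_in_real[of p q] q by auto
    obtain q' where q': "q' \<in> \<rat>" "p' < q'" "q' < q"
      using Rats_dense_in_real[of p' q] p' by auto
    have "\<exists>\<^sub>F y in F. g y \<le> p'"
    proof (rule ccontr)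
      assume "\<not> (\<exists>\<^sub>F y in F. g y \<le> p')"
      then have "\<forall>\<^sub>F y in F. ereal p' \<le> ?h y"
        by (auto simp: not_frequently elim: eventually_mono)
      from Liminf_bounded[OF this] have "ereal p' \<le> Liminf F ?h" .
      also have "\<dots> < ereal p" by (rule p)
      finally show False using p' by simp
    qed
    moreover have "\<exists>\<^sub>F y in F. q' \<le> g y"
    proof (rule ccontr)
      assume "\<not> (\<exists>\<^sub>F y in F. q' \<le> g y)"
      then have "\<forall>\<^sub>F y in F. ?h y \<le> ereal q'"
        by (auto simp: not_frequently elim: eventually_mono)
      from Limsup_bounded[OF this] q(2) have "ereal q < ereal q'" by (rule less_le_trans[rotated])
      then show False using q' by simp
    qed
    ultimately show False
      using osc p' q' by blast
  qed
  with Liminf_le_Limsup[OF assms(1)] have eq: "Liminf F ?h = Limsup F ?h"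
    by (meson order_antisym)
  obtain B where B: "\<forall>\<^sub>F y in F. \<bar>g y\<bar> < B"
    using bounded by blast
  have "Limsup F ?h \<le> ereal B"
    using B by (intro Limsup_bounded) (auto elim: eventually_mono)
  moreover have "ereal (- B) \<le> Liminf F ?h"
    using B by (intro Liminf_bounded) (auto elim!: eventually_mono)
  ultimately obtain l where l: "Limsup F ?h = ereal l"
    using eq by (cases "Limsup F ?h") auto
  have "(?h \<longlongrightarrow> ereal l) F"
    using tendsto_iff_Liminf_eq_Limsup[OF assms(1), of ?h "ereal l"] eq l by simp
  then show ?thesis
    by (auto simp: lim_ereal)
qed

lemma abs_cont_on_differentiable_AE_real:
  fixes f :: "real \<Rightarrow> real"
  assumes f: "abs_cont_on a b f"
  obtains N where "negligible N" "\<And>t. t \<in> {a<..<b} - N \<Longrightarrow> \<exists>l. (f has_real_derivative l) (at t)"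
proof -
  define s where "s t y = (f y - f t) / (y - t)" for t y
  define E where "E p q = {t \<in> {a<..<b}. (\<exists>\<^sub>F y in at t. s t y \<le> p) \<and> (\<exists>\<^sub>F y in at t. q \<le> s t y)}" for p q
  define N where "N = {t \<in> {a<..<b}. \<forall>q. \<exists>\<^sub>F y in at t. q \<le> \<bar>s t y\<bar>} \<union> (\<Union>(p,q)\<in>{(p,q). p \<in> \<rat> \<and> q \<in> \<rat> \<and> p < q}. E p q)"
  have "{(p::real,q). p \<in> \<rat> \<and> q \<in> \<rat> \<and> p < q} \<subseteq> \<rat> \<times> \<rat>"
    by auto
  then have "countable {(p::real,q). p \<in> \<rat> \<and> q \<in> \<rat> \<and> p < q}"
    using countable_rat by (meson countable_SIGMA countable_subset)
  moreover have "negligible (E p q)" if "p < q" for p q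
    using negligible_two_slopes[OF f that] unfolding E_def s_def .
  ultimately have "negligible (\<Union>(p,q)\<in>{(p,q). p \<in> \<rat> \<and> q \<in> \<rat> \<and> p < q}. E p q)"
    by (intro negligible_countable_Union) auto
  then have N: "negligible N"
    using negligible_unbounded_slopes[OF f] unfolding N_def s_def by simp
  have "\<exists>l. (f has_real_derivative l) (at t)" if "t \<in> {a<..<b} - N" for t
  proof -
    have "\<exists>l. (s t \<longlongrightarrow> l) (at t)"
    proof (rule tendsto_if_no_oscillation)
      have "\<not> (\<forall>q. \<exists>\<^sub>F y in at t. q \<le> \<bar>s t y\<bar>)"
        using that unfolding N_def by blast
      then show "\<exists>B. \<forall>\<^sub>F y in at t. \<bar>s t y\<bar> < B"
        by (simp add: not_frequently not_le)
      show False if "p < q" "p \<in> \<rat>" "q \<in> \<rat>" "\<exists>\<^sub>F y in at t. s t y \<le> p" "\<exists>\<^sub>F y in at t. q \<le> s t y" for p q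
        using \<open>t \<in> {a<..<b} - N\<close> that unfolding N_def E_def by blast
    qed simp
    then show ?thesis
      unfolding has_field_derivative_iff s_def .
  qed
  with N show ?thesis
    using that by blast
qed

lemma abs_cont_on_differentiable_AE:
  fixes f :: "real \<Rightarrow> 'a::euclidean_space"
  assumes f: "abs_cont_on a b f"
  obtains N where "negligible N"
    "\<And>t. t \<in> {a<..<b} - N \<Longrightarrow> (f has_vector_derivative vector_derivative f (at t)) (at t)"
proof -
  have "\<exists>N. negligible N \<and> (\<forall>t\<in>{a<..<b} - N. \<exists>l. ((\<lambda>t. f t \<bullet> i) has_real_derivative l) (at t))" if "i \<in> Basis" for i
  proof -
    have "abs_cont_on a b (\<lambda>t. f t \<bullet> i)"
    proof (rule abs_cont_on_compose_lipschitz[OF f, where L = 1])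
      show "norm (f t \<bullet> i - f s \<bullet> i) \<le> 1 * norm (f t - f s)" for s t
        using Basis_le_norm[OF that, of "f t - f s"] by (simp add: inner_diff_left)
    qed
    from abs_cont_on_differentiable_AE_real[OF this] show ?thesis
      by metis
  qed
  then obtain N where N: "\<And>i. i \<in> Basis \<Longrightarrow> negligible (N i)"
    "\<And>i t. \<lbrakk>i \<in> Basis; t \<in> {a<..<b} - N i\<rbrakk> \<Longrightarrow> \<exists>l. ((\<lambda>t. f t \<bullet> i) has_real_derivative l) (at t)"
    by metis
  have "negligible (\<Union>i\<in>Basis. N i)"
    using N(1) by (intro negligible_Union) auto
  moreover have "(f has_vector_derivative vector_derivative f (at t)) (at t)" if "t \<in> {a<..<b} - (\<Union>i\<in>Basis. N i)" for t
  proof -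
    have "\<forall>i\<in>Basis. \<exists>l. ((\<lambda>t. f t \<bullet> i) has_real_derivative l) (at t)"
      using N(2) that by blast
    then obtain l where "\<And>i. i \<in> Basis \<Longrightarrow> ((\<lambda>t. f t \<bullet> i) has_real_derivative l i) (at t)"
      by metis
    then have "((\<lambda>t. \<Sum>i\<in>Basis. (f t \<bullet> i) *\<^sub>R i) has_vector_derivative (\<Sum>i\<in>Basis. (f t \<bullet> i) *\<^sub>R 0 + l i *\<^sub>R i)) (at t)"
      by (intro has_vector_derivative_sum has_vector_derivative_scaleR has_vector_derivative_const) auto
    then show ?thesis
      by (auto simp: euclidean_representation vector_derivative_at)
  qed
  ultimately show ?thesis
    using that by blast
qed

text \<open>The fundamental theorem of calculus for absolutely continuous curves, as a gauge integral. A cell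
  tagged outside the null set is handled by the derivative at its tag, as in the classical theorem.
  Around tags in \<open>N\<close> the gauge keeps the cells inside an open set of measure below \<open>\<delta>\<close>, and
  absolute continuity makes the increments over these cells small in total.\<close>

theorem abs_cont_on_has_integral:
  fixes f :: "real \<Rightarrow> 'a::euclidean_space"
  assumes "a \<le> b" and f: "abs_cont_on a b f" and N: "negligible N"
    and deriv: "\<And>t. t \<in> {a..b} - N \<Longrightarrow> (f has_vector_derivative f' t) (at t within {a..b})"
  shows "(f' has_integral (f b - f a)) {a..b}"
proof -
  \<comment> \<open>On \<open>N\<close> the integrand may be changed to \<open>0\<close>, so that cells tagged there contribute only their
      increments.\<close>
  define g where "g t = (if t \<in> N then 0 else f' t)" for t
  have "(g has_integral (f b - f a)) {a..b}"
    unfolding has_integral_real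
  proof (intro allI impI)
    fix e :: real assume "0 < e"
    define e1 where "e1 = e / (2 * (b - a + 1))"
    have e1: "0 < e1" "e1 * (b - a) < e / 2"
      using \<open>0 < e\<close> \<open>a \<le> b\<close> by (auto simp: e1_def field_simps)
    have "\<exists>d>0. x \<in> {a..b} - N \<longrightarrow>
         (\<forall>y\<in>{a..b}. norm (y - x) < d \<longrightarrow> norm (f y - f x - (y - x) *\<^sub>R f' x) \<le> e1 * norm (y - x))" for x
      using deriv[unfolded has_vector_derivative_def has_derivative_within_alt] e1(1) by (cases "x \<in> {a..b} - N") (auto intro: zero_less_one)
    then obtain d where d: "\<And>x. 0 < d x"
      "\<And>x y. \<lbrakk>x \<in> {a..b} - N; y \<in> {a..b}; norm (y - x) < d x\<rbrakk>
         \<Longrightarrow> norm (f y - f x - (y - x) *\<^sub>R f' x) \<le> e1 * norm (y - x)"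
      by metis
    obtain \<delta> where "0 < \<delta>" and \<delta>: "\<And>D S. D division_of S \<Longrightarrow> S \<subseteq> {a..b} \<Longrightarrow> (\<Sum>k\<in>D. Sup k - Inf k) < \<delta>
        \<Longrightarrow> (\<Sum>k\<in>D. norm (f (Sup k) - f (Inf k))) < e / 2"
      using abs_cont_onD[OF f half_gt_zero[OF \<open>0 < e\<close>]] by metis
    obtain U where U: "open U" "N \<subseteq> U" "U \<in> lmeasurable" "measure lebesgue U < \<delta>"
      using lmeasurable_outer_open[OF negligible_imp_measurable[OF N] \<open>0 < \<delta>\<close>] negligible_imp_measure0[OF N]
      by auto
    have "\<exists>r>0. x \<in> N \<longrightarrow> ball x r \<subseteq> U" for x
      using U(1,2) by (cases "x \<in> N") (auto simp: open_contains_ball intro: zero_less_one)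
    then obtain r where r: "\<And>x. 0 < r x" "\<And>x. x \<in> N \<Longrightarrow> ball x (r x) \<subseteq> U"
      by metis
    define \<gamma> where "\<gamma> x = ball x (if x \<in> N then r x else d x)" for x
    show "\<exists>\<gamma>. gauge \<gamma> \<and> (\<forall>p. p tagged_division_of {a..b} \<and> \<gamma> fine p \<longrightarrow>
        norm ((\<Sum>(x,k)\<in>p. measure lborel k *\<^sub>R g x) - (f b - f a)) < e)"
    proof (intro exI[of _ \<gamma>] conjI allI impI)
      show "gauge \<gamma>"
        unfolding \<gamma>_def using d(1) r(1) by (intro gauge_ball_dependent) auto
      fix p assume "p tagged_division_of {a..b} \<and> \<gamma> fine p"
      then have p: "p tagged_division_of {a..b}" and fine: "\<gamma> fine p"
        by auto
      have "finite p"
        using p by auto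
      have cell: "k = {Inf k..Sup k}" "Inf k \<le> x" "x \<le> Sup k" "x \<in> k" "k \<subseteq> {a..b}" "k \<subseteq> \<gamma> x" if "(x,k) \<in> p" for x k
      proof -
        show "x \<in> k" "k \<subseteq> {a..b}" "k \<subseteq> \<gamma> x"
          using tagged_division_ofD(2,3)[OF p that] fineD[OF fine that] by auto
        moreover have "\<exists>u v. k = {u..v}"
          using tagged_division_ofD(4)[OF p that] by simp
        ultimately show "k = {Inf k..Sup k}" "Inf k \<le> x" "x \<le> Sup k"
          by auto
      qed
      let ?\<Delta> = "\<lambda>k. f (Sup k) - f (Inf k)"
      define A where "A = {xk \<in> p. fst xk \<in> N}"
      have regular: "norm (measure lborel k *\<^sub>R g x - ?\<Delta> k) \<le> e1 * (Sup k - Inf k)" if "(x,k) \<in> p - A" for x k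
      proof -
        have "(x,k) \<in> p" "x \<notin> N"
          using that by (auto simp: A_def)
        define u v where "u = Inf k" and "v = Sup k"
        note c = cell[OF \<open>(x,k) \<in> p\<close>, folded u_def v_def]
        have uv: "u \<in> k" "v \<in> k" "u \<le> v"
          using c by auto
        then have near: "norm (u - x) < d x" "norm (v - x) < d x"
          using c(6) \<open>x \<notin> N\<close> by (auto simp: \<gamma>_def dist_norm norm_minus_commute)
        have x: "x \<in> {a..b} - N" "u \<in> {a..b}" "v \<in> {a..b}"
          using c uv \<open>x \<notin> N\<close> by auto
        have "norm ((v - u) *\<^sub>R f' x - (f v - f u))
            = norm (f u - f x - (u - x) *\<^sub>R f' x - (f v - f x - (v - x) *\<^sub>R f' x))"
          by (simp add: algebra_simps)
        also have "\<dots> \<le> norm (f u - f x - (u - x) *\<^sub>R f' x) + norm (f v - f x - (v - x) *\<^sub>R f' x)"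
          by (rule norm_triangle_ineq4)
        also have "\<dots> \<le> e1 * norm (u - x) + e1 * norm (v - x)"
          using near x by (intro add_mono d) auto
        also have "\<dots> = e1 * (v - u)"
          using c by (simp add: algebra_simps)
        finally show ?thesis
          using \<open>x \<notin> N\<close> c(1) uv(3) by (simp add: g_def u_def[symmetric] v_def[symmetric])
      qed
      have A: "A tagged_partial_division_of {a..b}" "finite A"
        using tagged_partial_division_subset[of p _ A] p \<open>finite p\<close>
        by (auto simp: A_def tagged_division_of_def)
      have divA: "snd ` A division_of \<Union>(snd ` A)"
        using partial_division_of_tagged_division[OF A(1)] .
      have singular: "(\<Sum>(x,k)\<in>A. norm (measure lborel k *\<^sub>R g x - ?\<Delta> k)) < e / 2"
      proof -
        \<comment> \<open>\<open>Inf {}\<close> and \<open>Sup {}\<close> are unspecified reals, hence the case distinction.\<close>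
        let ?d = "\<lambda>k. if k = {} then 0 else norm (?\<Delta> k)"
        have "(\<Sum>(x,k)\<in>A. norm (measure lborel k *\<^sub>R g x - ?\<Delta> k)) = (\<Sum>(x,k)\<in>A. ?d k)"
        proof (rule sum.cong)
          fix xk assume xk: "xk \<in> A"
          obtain x k where [simp]: "xk = (x,k)"
            by fastforce
          have "x \<in> N" "x \<in> k"
            using xk cell(4)[of x k] by (auto simp: A_def)
          then show "(case xk of (x,k) \<Rightarrow> norm (measure lborel k *\<^sub>R g x - ?\<Delta> k)) = (case xk of (x,k) \<Rightarrow> ?d k)"
            by (auto simp: g_def norm_minus_commute)
        qed simp
        also have "\<dots> = (\<Sum>k\<in>snd ` A. ?d k)"
        proof (rule sum.over_tagged_division_lemma)
          show "A tagged_division_of \<Union>(snd ` A)"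
            using tagged_partial_division_of_Union_self[OF A(1)] .
          show "?d (cbox u v) = 0" if "box u v = {}" for u v
            using that by (cases "u = v") (auto simp: not_less)
        qed
        also have "\<dots> = (\<Sum>k\<in>snd ` A. norm (?\<Delta> k))"
          using division_ofD(3)[OF divA] by (intro sum.cong) auto
        also have "\<dots> < e / 2"
        proof (rule \<delta>[OF divA])
          show "\<Union>(snd ` A) \<subseteq> {a..b}"
            using cell(5) by (force simp: A_def)
          have "\<Union>(snd ` A) \<subseteq> U"
          proof -
            have "k \<subseteq> U" if "(x,k) \<in> A" for x k
              using that cell(6)[of x k] r(2)[of x] by (auto simp: A_def \<gamma>_def)
            then show ?thesis by force
          qed
          then have "measure lebesgue (\<Union>(snd ` A)) \<le> measure lebesgue U"
            using U(3) lmeasurable_division[OF divA] by (intro measure_mono_fmeasurable) auto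
          then show "(\<Sum>k\<in>snd ` A. Sup k - Inf k) < \<delta>"
            using sum_lengths_eq_measure[OF divA] U(4) by simp
        qed
        finally show ?thesis .
      qed
      have "(\<Sum>(x,k)\<in>p. measure lborel k *\<^sub>R g x) - (f b - f a) = (\<Sum>(x,k)\<in>p. measure lborel k *\<^sub>R g x - ?\<Delta> k)"
        using additive_tagged_division_1[OF \<open>a \<le> b\<close> p, of f] by (simp add: sum_subtractf split_def)
      also have "norm \<dots> \<le> (\<Sum>(x,k)\<in>p. norm (measure lborel k *\<^sub>R g x - ?\<Delta> k))"
        by (rule sum_norm_le) auto
      also have "\<dots> = (\<Sum>(x,k)\<in>p - A. norm (measure lborel k *\<^sub>R g x - ?\<Delta> k)) + (\<Sum>(x,k)\<in>A. norm (measure lborel k *\<^sub>R g x - ?\<Delta> k))"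
        using \<open>finite p\<close> by (intro sum.subset_diff) (auto simp: A_def)
      also have "(\<Sum>(x,k)\<in>p - A. norm (measure lborel k *\<^sub>R g x - ?\<Delta> k)) \<le> (\<Sum>(x,k)\<in>p - A. e1 * (Sup k - Inf k))"
        using regular by (intro sum_mono) auto
      also have "\<dots> \<le> (\<Sum>(x,k)\<in>p. e1 * (Sup k - Inf k))"
        using cell(2,3) e1(1) \<open>finite p\<close> by (intro sum_mono2) (force intro: mult_nonneg_nonneg)+
      also have "\<dots> = e1 * (b - a)"
        using additive_tagged_division_1[OF \<open>a \<le> b\<close> p, of "\<lambda>x. x"] by (simp add: sum_distrib_left[symmetric] split_def)
      finally show "norm ((\<Sum>(x,k)\<in>p. measure lborel k *\<^sub>R g x) - (f b - f a)) < e"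
        using singular e1(2) by linarith
    qed
  qed
  then show ?thesis
    by (rule has_integral_spike[OF N, rotated]) (auto simp: g_def)
qed

lemma abs_cont_on_constant:
  fixes f :: "real \<Rightarrow> 'a::euclidean_space"
  assumes f: "abs_cont_on a b f" and N: "negligible N"
    and deriv: "\<And>s. s \<in> {a..b} - N \<Longrightarrow> (f has_vector_derivative 0) (at s)" and t: "t \<in> {a..b}"
  shows "f t = f a"
proof -
  have "((\<lambda>_. 0) has_integral (f t - f a)) {a..t}"
    by (rule abs_cont_on_has_integral[OF _ _ N])
      (use t deriv abs_cont_on_subinterval[OF f] in \<open>auto intro: has_vector_derivative_at_within\<close>)
  then show ?thesis
    by (simp add: has_integral_0_eq)
qed

lemma abs_cont_on_vector_derivative:
  fixes f :: "real \<Rightarrow> 'a::euclidean_space"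
  assumes f: "abs_cont_on a b f"
  obtains N where "negligible N"
    "\<And>t. t \<in> {a..b} - N \<Longrightarrow> (f has_vector_derivative vector_derivative f (at t within {a..b})) (at t)"
proof -
  obtain N where N: "negligible N"
    "\<And>t. t \<in> {a<..<b} - N \<Longrightarrow> (f has_vector_derivative vector_derivative f (at t)) (at t)"
    using abs_cont_on_differentiable_AE[OF f] by metis
  show ?thesis
  proof
    show "negligible (N \<union> {a,b})"
      using N(1) by simp
    show "(f has_vector_derivative vector_derivative f (at t within {a..b})) (at t)"
      if "t \<in> {a..b} - (N \<union> {a,b})" for t
    proof -
      have "t \<in> {a<..<b} - N"
        using that by auto
      then show ?thesis
        using N(2)[of t] by (simp add: at_within_Icc_at)
    qed
  qed
qed

lemma abs_cont_on_vector_derivative_measurable: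
  fixes f :: "real \<Rightarrow> 'a::euclidean_space"
  assumes "a \<le> b" "abs_cont_on a b f"
  shows "(\<lambda>t. vector_derivative f (at t within {a..b})) \<in> borel_measurable (lebesgue_on {a..b})"
proof -
  obtain N where N: "negligible N"
    "\<And>t. t \<in> {a..b} - N \<Longrightarrow> (f has_vector_derivative vector_derivative f (at t within {a..b})) (at t)"
    using abs_cont_on_vector_derivative[OF assms(2)] by metis
  have "((\<lambda>t. vector_derivative f (at t within {a..b})) has_integral (f b - f a)) {a..b}"
    by (rule abs_cont_on_has_integral[OF assms N(1)]) (rule has_vector_derivative_at_within[OF N(2)])
  then show ?thesis
    by (intro integrable_imp_measurable) (rule has_integral_integrable)
qed

section \<open>Quadratic energy of a curve on a line\<close>

text \<open>Derivatives are only Lebesgue measurable, while the action is an integral over \<open>lborel\<close>.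
  Completing the measure does not change nonnegative integrals.\<close>

lemma set_nn_integral_lebesgue_on:
  fixes S :: "'a::euclidean_space set"
  assumes "S \<in> sets lebesgue"
  shows "(\<integral>\<^sup>+t\<in>S. f t \<partial>lborel) = (\<integral>\<^sup>+t. f t \<partial>lebesgue_on S)"
  using assms by (subst nn_integral_restrict_space) (auto simp: nn_integral_completion)

lemma AE_lebesgue_on_iff_negligible:
  fixes S :: "'a::euclidean_space set"
  assumes "S \<in> sets lebesgue"
  shows "(AE t in lebesgue_on S. P t) \<longleftrightarrow> negligible {t \<in> S. \<not> P t}"
proof -
  have "(AE t in lebesgue_on S. P t) \<longleftrightarrow> (AE t in lebesgue. t \<in> S \<longrightarrow> P t)"
    using assms by (subst AE_restrict_space_iff) auto
  also have "\<dots> \<longleftrightarrow> negligible {t \<in> S. \<not> P t}"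
  proof
    assume "AE t in lebesgue. t \<in> S \<longrightarrow> P t"
    then obtain N where "{t \<in> space lebesgue. \<not> (t \<in> S \<longrightarrow> P t)} \<subseteq> N" "N \<in> null_sets lebesgue"
      by (auto simp: eventually_ae_filter)
    then show "negligible {t \<in> S. \<not> P t}"
      using negligible_iff_null_sets by (auto intro: negligible_subset)
  next
    assume "negligible {t \<in> S. \<not> P t}"
    then show "AE t in lebesgue. t \<in> S \<longrightarrow> P t"
      by (intro AE_I'[of "{t \<in> S. \<not> P t}"]) (auto simp: negligible_iff_null_sets)
  qed
  finally show ?thesis .
qed

text \<open>With the mean velocity \<open>k = (u b - u a) / (b - a)\<close>, the fundamental theorem of calculus gives
  \<open>\<integral> w\<^sup>2 = k\<^sup>2 * (b - a) + \<integral> (w - k)\<^sup>2\<close>. Equality forces \<open>w = k\<close> almost everywhere, and so \<open>u\<close> is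
  affine.\<close>

lemma velocity_energy_bound:
  fixes u w :: "real \<Rightarrow> real"
  assumes "a < b" and u: "abs_cont_on a b u" and N: "negligible N"
    and deriv: "\<And>t. t \<in> {a..b} - N \<Longrightarrow> (u has_vector_derivative w t) (at t within {a..b})"
  shows "ennreal ((u b - u a)\<^sup>2 / (b - a)) \<le> (\<integral>\<^sup>+t. ennreal ((w t)\<^sup>2) \<partial>lebesgue_on {a..b})" (is "?D \<le> ?I")
    and "\<lbrakk>(\<integral>\<^sup>+t. ennreal ((w t)\<^sup>2) \<partial>lebesgue_on {a..b}) = ennreal ((u b - u a)\<^sup>2 / (b - a)); t \<in> {a..b}\<rbrakk>
      \<Longrightarrow> u t = u a + (t - a) / (b - a) * (u b - u a)"
proof -
  define k where "k = (u b - u a) / (b - a)"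
  have w_int: "(w has_integral (u t - u a)) {a..t}" if "t \<in> {a..b}" for t
  proof (rule abs_cont_on_has_integral[OF _ _ N])
    show "a \<le> t" using that by simp
    show "abs_cont_on a t u"
      using abs_cont_on_subinterval[OF u, of a t] that by simp
    show "(u has_vector_derivative w s) (at s within {a..t})" if "s \<in> {a..t} - N" for s
      by (rule has_vector_derivative_within_subset[OF deriv]) (use that \<open>t \<in> {a..b}\<close> in auto)
  qed
  have w_meas: "w \<in> borel_measurable (lebesgue_on {a..b})"
    using w_int[of b] \<open>a < b\<close> by (intro integrable_imp_measurable) (auto intro: has_integral_integrable)
  have gap: "\<exists>J. ((\<lambda>t. (w t - k)\<^sup>2) has_integral J) {a..b} \<and> 0 \<le> J \<and> ?I = ennreal ((u b - u a)\<^sup>2 / (b - a) + J)"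
    if fin: "?I < \<infinity>"
  proof -
    have "integrable (lebesgue_on {a..b}) (\<lambda>t. (w t)\<^sup>2)"
      using fin w_meas by (intro integrableI_bounded) auto
    then obtain I where I: "((\<lambda>t. (w t)\<^sup>2) has_integral I) {a..b}"
      using integrable_on_lebesgue_on[of "{a..b}" "\<lambda>t. (w t)\<^sup>2"] unfolding integrable_on_def by auto
    have "?I = ennreal I"
      using nn_integral_has_integral_lebesgue'[OF _ I]
      by (subst set_nn_integral_lebesgue_on[symmetric]) auto
    have "((\<lambda>t. (w t)\<^sup>2 - 2 * k * w t + k\<^sup>2) has_integral (I - 2 * k * (u b - u a) + k\<^sup>2 * (b - a))) {a..b}"
      using I w_int[of b] has_integral_const_real[of "k\<^sup>2" a b] \<open>a < b\<close>
      by (intro has_integral_add has_integral_diff has_integral_mult_right) (auto simp: mult.commute)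
    moreover have "(w t)\<^sup>2 - 2 * k * w t + k\<^sup>2 = (w t - k)\<^sup>2" for t
      by (simp add: power2_eq_square algebra_simps)
    moreover have "I - 2 * k * (u b - u a) + k\<^sup>2 * (b - a) = I - (u b - u a)\<^sup>2 / (b - a)"
    proof -
      have "k * (b - a) = u b - u a"
        using \<open>a < b\<close> by (simp add: k_def)
      then have "k\<^sup>2 * (b - a) = k * (u b - u a)"
        by (simp add: power2_eq_square mult.assoc)
      moreover have "(u b - u a)\<^sup>2 / (b - a) = k * (u b - u a)"
        by (simp add: k_def power2_eq_square)
      ultimately show ?thesis
        by simp
    qed
    ultimately have J: "((\<lambda>t. (w t - k)\<^sup>2) has_integral (I - (u b - u a)\<^sup>2 / (b - a))) {a..b}"
      by simp
    moreover have "0 \<le> I - (u b - u a)\<^sup>2 / (b - a)"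
      by (rule has_integral_nonneg[OF J]) simp
    ultimately show ?thesis
      using \<open>?I = ennreal I\<close> by (intro exI[of _ "I - (u b - u a)\<^sup>2 / (b - a)"]) simp
  qed
  show "?D \<le> ?I"
  proof (cases "?I < \<infinity>")
    case True
    then obtain J where "0 \<le> J" "?I = ennreal ((u b - u a)\<^sup>2 / (b - a) + J)"
      using gap by blast
    then show ?thesis
      by (simp only:) (rule ennreal_leI, simp)
  next
    case False
    then show ?thesis
      by (simp add: not_less top_unique)
  qed
  assume eq: "?I = ?D" and t: "t \<in> {a..b}"
  have "?I < \<infinity>"
    unfolding eq by simp
  then obtain J where J: "((\<lambda>t. (w t - k)\<^sup>2) has_integral J) {a..b}" "0 \<le> J"
      "?I = ennreal ((u b - u a)\<^sup>2 / (b - a) + J)"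
    using gap by blast
  have "J = 0"
  proof -
    have "0 \<le> (u b - u a)\<^sup>2 / (b - a)"
      using \<open>a < b\<close> by simp
    moreover have "ennreal ((u b - u a)\<^sup>2 / (b - a) + J) = ennreal ((u b - u a)\<^sup>2 / (b - a))"
      using J(3) eq by simp
    ultimately show ?thesis
      using \<open>0 \<le> J\<close> by (simp del: ennreal_plus)
  qed
  have "(\<integral>\<^sup>+t. ennreal ((w t - k)\<^sup>2) \<partial>lebesgue_on {a..b}) = 0"
    using nn_integral_has_integral_lebesgue'[OF _ J(1)] \<open>J = 0\<close>
    by (subst set_nn_integral_lebesgue_on[symmetric]) auto
  then have "AE t in lebesgue_on {a..b}. ennreal ((w t - k)\<^sup>2) = 0"
    using w_meas by (subst (asm) nn_integral_0_iff_AE) auto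
  then have "AE t in lebesgue_on {a..b}. w t = k"
    by eventually_elim simp
  then have neg: "negligible {t \<in> {a..b}. w t \<noteq> k}"
    by (subst (asm) AE_lebesgue_on_iff_negligible) auto
  have "((\<lambda>_. k) has_integral (u t - u a)) {a..t}"
    using t by (intro has_integral_spike[OF neg _ w_int[OF t]]) auto
  moreover have "((\<lambda>_. k) has_integral (t - a) * k) {a..t}"
    using has_integral_const_real[of k a t] t by simp
  ultimately have "u t - u a = (t - a) * k"
    by (rule has_integral_unique)
  then show "u t = u a + (t - a) / (b - a) * (u b - u a)"
    by (simp add: k_def)
qed

text \<open>The calibration principle used for both kinds of geodesics: if the energy density splits into the
  squared velocity of a scalar function \<open>u\<close> and a nonnegative remainder \<open>\<rho>\<close>, then the energy is
  bounded below by the increment of \<open>u\<close>, and equality determines both \<open>u\<close> and the vanishing of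
  \<open>\<rho>\<close>.\<close>

theorem energy_bound:
  fixes u w \<rho> :: "real \<Rightarrow> real" and e :: "real \<Rightarrow> ennreal"
  assumes "a < b" and u: "abs_cont_on a b u" and N: "negligible N"
    and deriv: "\<And>t. t \<in> {a..b} - N \<Longrightarrow> (u has_vector_derivative w t) (at t within {a..b})"
    and \<rho>: "\<rho> \<in> borel_measurable (lebesgue_on {a..b})" "\<And>t. 0 \<le> \<rho> t"
    and e: "\<And>t. t \<in> {a..b} - N \<Longrightarrow> e t = ennreal (((w t)\<^sup>2 + \<rho> t) / 2)"
  shows "ennreal ((u b - u a)\<^sup>2 / (2 * (b - a))) \<le> (\<integral>\<^sup>+t\<in>{a..b}. e t \<partial>lborel)" (is "?D \<le> ?E")
    and "\<lbrakk>(\<integral>\<^sup>+t\<in>{a..b}. e t \<partial>lborel) = ennreal ((u b - u a)\<^sup>2 / (2 * (b - a))); t \<in> {a..b}\<rbrakk>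
      \<Longrightarrow> u t = u a + (t - a) / (b - a) * (u b - u a)"
    and "(\<integral>\<^sup>+t\<in>{a..b}. e t \<partial>lborel) = ennreal ((u b - u a)\<^sup>2 / (2 * (b - a)))
      \<Longrightarrow> negligible {t \<in> {a..b}. \<rho> t \<noteq> 0}"
proof -
  let ?M = "lebesgue_on {a..b}"
  define W where "W = (\<integral>\<^sup>+t. ennreal ((w t)\<^sup>2) \<partial>?M)"
  define R where "R = (\<integral>\<^sup>+t. ennreal (\<rho> t) \<partial>?M)"
  have "(w has_integral (u b - u a)) {a..b}"
    using abs_cont_on_has_integral[OF _ u N deriv] \<open>a < b\<close> by simp
  then have w: "w \<in> borel_measurable ?M"
    by (intro integrable_imp_measurable) (rule has_integral_integrable)
  have "AE t in ?M. t \<notin> N"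
    using N by (subst AE_lebesgue_on_iff_negligible) (auto intro: negligible_subset)
  have "?E = (\<integral>\<^sup>+t. e t \<partial>?M)"
    by (simp add: set_nn_integral_lebesgue_on)
  also have "\<dots> = (\<integral>\<^sup>+t. ennreal (1/2) * (ennreal ((w t)\<^sup>2) + ennreal (\<rho> t)) \<partial>?M)"
  proof (rule nn_integral_cong_AE)
    have "AE t in ?M. t \<in> {a..b}"
      by (rule AE_I2) (simp add: space_restrict_space)
    with \<open>AE t in ?M. t \<notin> N\<close> show "AE t in ?M. e t = ennreal (1/2) * (ennreal ((w t)\<^sup>2) + ennreal (\<rho> t))"
    proof eventually_elim
      case (elim t)
      then have "e t = ennreal (((w t)\<^sup>2 + \<rho> t) / 2)"
        using e by simp
      also have "\<dots> = ennreal (1/2) * (ennreal ((w t)\<^sup>2) + ennreal (\<rho> t))"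
      proof -
        have "((w t)\<^sup>2 + \<rho> t) / 2 = 1 / 2 * ((w t)\<^sup>2 + \<rho> t)"
          by simp
        then show ?thesis
          using \<rho>(2)[of t] by (simp only: ennreal_mult ennreal_plus zero_le_power2 add_nonneg_nonneg)
      qed
      finally show ?case .
    qed
  qed
  also have "\<dots> = ennreal (1/2) * (W + R)"
    using w \<rho>(1) unfolding W_def R_def by (simp add: nn_integral_cmult nn_integral_add)
  finally have E: "?E = ennreal (1/2) * (W + R)" .
  have D: "?D = ennreal (1/2) * ennreal ((u b - u a)\<^sup>2 / (b - a))"
  proof -
    have "(u b - u a)\<^sup>2 / (2 * (b - a)) = 1 / 2 * ((u b - u a)\<^sup>2 / (b - a))"
      by simp
    then show ?thesis
      using \<open>a < b\<close> by (simp only:) (rule ennreal_mult; simp)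
  qed
  have W: "ennreal ((u b - u a)\<^sup>2 / (b - a)) \<le> W"
    unfolding W_def by (rule velocity_energy_bound(1)[OF assms(1-3) deriv])
  show "?D \<le> ?E"
    unfolding D E using W by (intro mult_left_mono) (auto intro: add_increasing2)
  have split: "W = ennreal ((u b - u a)\<^sup>2 / (b - a)) \<and> R = 0" if "?E = ?D"
  proof -
    have total: "W + R = ennreal ((u b - u a)\<^sup>2 / (b - a))"
      using that unfolding E D by (subst (asm) ennreal_mult_cancel_left) auto
    moreover have "W \<le> W + R"
      by simp
    ultimately have WD: "W = ennreal ((u b - u a)\<^sup>2 / (b - a))"
      using W by (metis order_antisym)
    have "W + R = W + 0"
      using total WD by simp
    moreover have "W \<noteq> top"
      unfolding WD by simp
    ultimately have "R = 0"
      using ennreal_add_left_cancel[of W R 0] by (simp add: infinity_ennreal_def)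
    with WD show ?thesis by simp
  qed
  show "u t = u a + (t - a) / (b - a) * (u b - u a)" if "?E = ?D" "t \<in> {a..b}"
    using velocity_energy_bound(2)[OF assms(1-3) deriv _ that(2)] split[OF that(1)] by (simp add: W_def)
  show "negligible {t \<in> {a..b}. \<rho> t \<noteq> 0}" if "?E = ?D"
  proof -
    have "(\<integral>\<^sup>+t. ennreal (\<rho> t) \<partial>?M) = 0"
      using split[OF that] by (simp add: R_def)
    then have "AE t in ?M. ennreal (\<rho> t) = 0"
      using \<rho>(1) by (subst (asm) nn_integral_0_iff_AE) auto
    then have "AE t in ?M. \<not> (\<rho> t \<noteq> 0)"
    proof eventually_elim
      case (elim t)
      then show ?case
        using \<rho>(2)[of t] by (simp add: ennreal_eq_0_iff)
    qed
    then show ?thesis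
      by (subst (asm) AE_lebesgue_on_iff_negligible) auto
  qed
qed

section \<open>Lower bounds for the action\<close>

text \<open>Derivatives are taken within the full interval \<open>[0, 1]\<close> also when the density is integrated over
  a shorter one, so that it stays literally the integrand of the action.\<close>

abbreviation action_density :: "(real \<Rightarrow> 'a::euclidean_space) \<Rightarrow> (real \<Rightarrow> real) \<Rightarrow> real \<Rightarrow> ennreal" where
  "action_density m \<sigma> t \<equiv> ennreal ((norm (vector_derivative m (at t within {0..1})))\<^sup>2
      + (vector_derivative \<sigma> (at t within {0..1}))\<^sup>2) / ennreal (2 * (\<sigma> t)\<^sup>2)"

lemma action_density_positive:
  assumes "0 < \<sigma> t"
  shows "action_density m \<sigma> t = ennreal (((norm (vector_derivative m (at t within {0..1})))\<^sup>2
      + (vector_derivative \<sigma> (at t within {0..1}))\<^sup>2) / (\<sigma> t)\<^sup>2 / 2)"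
  using assms by (subst divide_ennreal) (auto simp: field_simps)

lemma derivative_measurable_subinterval:
  fixes f :: "real \<Rightarrow> 'a::euclidean_space"
  assumes "abs_cont_on 0 1 f" "b \<le> 1"
  shows "(\<lambda>t. vector_derivative f (at t within {0..1})) \<in> borel_measurable (lebesgue_on {0..b})"
proof -
  have "(\<lambda>t. vector_derivative f (at t within {0..1})) \<in> borel_measurable (lebesgue_on {0..1})"
    using abs_cont_on_vector_derivative_measurable[OF _ assms(1)] by simp
  then show ?thesis
    by (rule measurable_restrict_mono) (use assms(2) in auto)
qed

lemma abs_cont_on_measurable:
  fixes f :: "real \<Rightarrow> 'a::euclidean_space"
  assumes "abs_cont_on a b f"
  shows "f \<in> borel_measurable (lebesgue_on {a..b})"
  by (rule continuous_imp_measurable_on_sets_lebesgue[OF abs_cont_on_continuous[OF assms]]) simp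

text \<open>Calibration by \<open>u = ln \<sigma>\<close>: the density is \<open>(u'\<^sup>2 + \<parallel>m'\<parallel>\<^sup>2 / \<sigma>\<^sup>2) / 2\<close>. For \<open>b = 1\<close> this settles the
  case of equal means. For \<open>b < 1\<close> it bounds \<open>\<sigma>\<close> from below as long as it has not vanished.\<close>

lemma log_energy_bound:
  fixes m :: "real \<Rightarrow> 'a::euclidean_space" and \<sigma> :: "real \<Rightarrow> real"
  assumes m: "abs_cont_on 0 1 m" and \<sigma>: "abs_cont_on 0 1 \<sigma>" and b: "0 < b" "b \<le> 1"
    and pos: "\<And>t. t \<in> {0..b} \<Longrightarrow> 0 < \<sigma> t"
  shows "ennreal ((ln (\<sigma> b) - ln (\<sigma> 0))\<^sup>2 / (2 * b)) \<le> (\<integral>\<^sup>+t\<in>{0..b}. action_density m \<sigma> t \<partial>lborel)" (is "?D \<le> ?E")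
    and "\<lbrakk>(\<integral>\<^sup>+t\<in>{0..b}. action_density m \<sigma> t \<partial>lborel) = ennreal ((ln (\<sigma> b) - ln (\<sigma> 0))\<^sup>2 / (2 * b)); t \<in> {0..b}\<rbrakk>
      \<Longrightarrow> ln (\<sigma> t) = ln (\<sigma> 0) + t / b * (ln (\<sigma> b) - ln (\<sigma> 0)) \<and> m t = m 0"
proof -
  let ?m' = "\<lambda>t. vector_derivative m (at t within {0..1})"
  let ?\<sigma>' = "\<lambda>t. vector_derivative \<sigma> (at t within {0..1})"
  obtain Nm where Nm: "negligible Nm" "\<And>t. t \<in> {0..1} - Nm \<Longrightarrow> (m has_vector_derivative ?m' t) (at t)"
    using abs_cont_on_vector_derivative[OF m] by metis
  obtain Ns where Ns: "negligible Ns" "\<And>t. t \<in> {0..1} - Ns \<Longrightarrow> (\<sigma> has_vector_derivative ?\<sigma>' t) (at t)"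
    using abs_cont_on_vector_derivative[OF \<sigma>] by metis
  have m_b: "abs_cont_on 0 b m" and \<sigma>_b: "abs_cont_on 0 b \<sigma>"
    using abs_cont_on_subinterval[OF m, of 0 b] abs_cont_on_subinterval[OF \<sigma>, of 0 b] b by simp_all
  obtain \<delta> where "0 < \<delta>" "\<And>t. t \<in> {0..b} \<Longrightarrow> \<delta> \<le> \<sigma> t"
    using positive_lower_bound[OF \<sigma>_b pos] by metis
  then have u: "abs_cont_on 0 b (\<lambda>t. ln (\<sigma> t))"
    by (intro abs_cont_on_ln[OF \<sigma>_b])
  have deriv: "((\<lambda>t. ln (\<sigma> t)) has_vector_derivative (?\<sigma>' t / \<sigma> t)) (at t within {0..b})" if "t \<in> {0..b} - Ns" for t
  proof -
    have "(\<sigma> has_real_derivative ?\<sigma>' t) (at t)"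
      using Ns(2)[of t] that b by (simp add: has_real_derivative_iff_has_vector_derivative)
    then have "((\<lambda>t. ln (\<sigma> t)) has_real_derivative (inverse (\<sigma> t) * ?\<sigma>' t)) (at t)"
      using pos[of t] that by (intro DERIV_chain2[OF DERIV_ln]) auto
    then show ?thesis
      by (auto simp: has_real_derivative_iff_has_vector_derivative divide_inverse mult.commute
          intro: has_vector_derivative_at_within)
  qed
  define \<rho> where "\<rho> t = (norm (?m' t) / \<sigma> t)\<^sup>2" for t
  have "\<rho> \<in> borel_measurable (lebesgue_on {0..b})"
    unfolding \<rho>_def using derivative_measurable_subinterval[OF m b(2)] abs_cont_on_measurable[OF \<sigma>_b]
    by measurable
  moreover have "0 \<le> \<rho> t" for t
    by (simp add: \<rho>_def)
  moreover have "action_density m \<sigma> t = ennreal (((?\<sigma>' t / \<sigma> t)\<^sup>2 + \<rho> t) / 2)" if "t \<in> {0..b} - Ns" for t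
  proof -
    have "0 < \<sigma> t"
      using that pos by simp
    from action_density_positive[where \<sigma> = \<sigma> and t = t and m = m, OF this] show ?thesis
      by (simp add: \<rho>_def power_divide add_divide_distrib[symmetric] add.commute del: ennreal_plus)
  qed
  ultimately have prems: "\<rho> \<in> borel_measurable (lebesgue_on {0..b})" "\<And>t. 0 \<le> \<rho> t"
    "\<And>t. t \<in> {0..b} - Ns \<Longrightarrow> action_density m \<sigma> t = ennreal (((?\<sigma>' t / \<sigma> t)\<^sup>2 + \<rho> t) / 2)"
    by auto
  note bound = energy_bound[where e = "action_density m \<sigma>", OF b(1) u Ns(1) deriv prems, unfolded diff_zero]
  show "?D \<le> ?E"
    by (rule bound(1))
  show "ln (\<sigma> t) = ln (\<sigma> 0) + t / b * (ln (\<sigma> b) - ln (\<sigma> 0)) \<and> m t = m 0" if "?E = ?D" "t \<in> {0..b}"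
  proof
    show "ln (\<sigma> t) = ln (\<sigma> 0) + t / b * (ln (\<sigma> b) - ln (\<sigma> 0))"
      by (rule bound(2)[OF _ _ that])
    have "negligible {t \<in> {0..b}. \<rho> t \<noteq> 0}"
      by (rule bound(3)[OF _ _ that(1)])
    then have "negligible (Nm \<union> {t \<in> {0..b}. \<rho> t \<noteq> 0})"
      using Nm(1) by simp
    then show "m t = m 0"
    proof (rule abs_cont_on_constant[OF m_b _ _ that(2)])
      fix s assume s: "s \<in> {0..b} - (Nm \<union> {t \<in> {0..b}. \<rho> t \<noteq> 0})"
      then have "?m' s = 0"
        using pos[of s] by (auto simp: \<rho>_def)
      then show "(m has_vector_derivative 0) (at s)"
        using Nm(2)[of s] s b by simp
    qed
  qed
qed

text \<open>Before its first zero \<open>\<tau>\<close>, the logarithm of \<open>\<sigma>\<close> can change by at most \<open>sqrt (2 * A)\<close>, where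
  \<open>A\<close> is the action. This keeps \<open>\<sigma>\<close> away from \<open>0\<close> up to \<open>\<tau>\<close>, contradicting continuity.\<close>

lemma finite_action_imp_positive:
  fixes m :: "real \<Rightarrow> 'a::euclidean_space" and \<sigma> :: "real \<Rightarrow> real"
  assumes m: "abs_cont_on 0 1 m" and \<sigma>: "abs_cont_on 0 1 \<sigma>" and "0 < \<sigma> 0"
    and nonneg: "\<And>t. t \<in> {0..1} \<Longrightarrow> 0 \<le> \<sigma> t" and finite: "action m \<sigma> < \<infinity>" and t: "t \<in> {0..1}"
  shows "0 < \<sigma> t"
proof (rule ccontr)
  assume "\<not> 0 < \<sigma> t"
  define Z where "Z = {0..1} \<inter> \<sigma> -` {0}"
  have "t \<in> Z"
    using \<open>\<not> 0 < \<sigma> t\<close> nonneg[OF t] t by (auto simp: Z_def)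
  have "closed Z"
    unfolding Z_def by (intro continuous_closed_preimage abs_cont_on_continuous[OF \<sigma>]) auto
  define \<tau> where "\<tau> = Inf Z"
  have "bdd_below Z"
    by (auto simp: Z_def)
  have "\<tau> \<in> Z"
    unfolding \<tau>_def using \<open>t \<in> Z\<close> \<open>closed Z\<close> \<open>bdd_below Z\<close> by (intro closed_contains_Inf) auto
  then have \<tau>: "\<tau> \<in> {0..1}" "\<sigma> \<tau> = 0"
    by (auto simp: Z_def)
  have "0 < \<tau>"
    using \<tau> \<open>0 < \<sigma> 0\<close> by (cases "\<tau> = 0") auto
  have before: "0 < \<sigma> s" if "s \<in> {0..<\<tau>}" for s
  proof -
    have "s \<notin> Z"
      using cInf_lower[OF _ \<open>bdd_below Z\<close>, of s] that by (auto simp: \<tau>_def)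
    then show ?thesis
      using nonneg[of s] that \<tau>(1) by (force simp: Z_def)
  qed
  obtain A where A: "action m \<sigma> = ennreal A" "0 \<le> A"
    using finite by (cases "action m \<sigma>") auto
  define c where "c = \<sigma> 0 * exp (- sqrt (2 * A))"
  have "0 < c"
    using \<open>0 < \<sigma> 0\<close> by (simp add: c_def)
  have lower: "c \<le> \<sigma> s" if s: "0 < s" "s < \<tau>" for s
  proof -
    have "ennreal ((ln (\<sigma> s) - ln (\<sigma> 0))\<^sup>2 / (2 * s)) \<le> (\<integral>\<^sup>+t\<in>{0..s}. action_density m \<sigma> t \<partial>lborel)"
      using s \<tau>(1) before by (intro log_energy_bound(1)[OF m \<sigma>]) auto
    also have "\<dots> \<le> action m \<sigma>"
      unfolding action_def using s \<tau>(1) by (intro nn_integral_mono) (auto simp: indicator_def)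
    finally have "(ln (\<sigma> s) - ln (\<sigma> 0))\<^sup>2 / (2 * s) \<le> A"
      using A by simp
    then have "(ln (\<sigma> s) - ln (\<sigma> 0))\<^sup>2 \<le> A * (2 * s)"
      using s by (simp add: pos_divide_le_eq)
    also have "\<dots> \<le> 2 * A"
      using A(2) s \<tau>(1) mult_left_le[of s A] by (simp add: mult.commute)
    finally have "\<bar>ln (\<sigma> s) - ln (\<sigma> 0)\<bar> \<le> sqrt (2 * A)"
      by (metis real_sqrt_abs real_sqrt_le_iff)
    then have "ln (\<sigma> 0) - sqrt (2 * A) \<le> ln (\<sigma> s)"
      by linarith
    then have "exp (ln (\<sigma> 0) - sqrt (2 * A)) \<le> \<sigma> s"
      using before[of s] s by (simp add: ln_ge_iff)
    then show ?thesis
      using \<open>0 < \<sigma> 0\<close> by (simp add: c_def exp_diff exp_minus divide_inverse)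
  qed
  obtain d where d: "0 < d" "\<And>s. \<lbrakk>s \<in> {0..1}; dist s \<tau> < d\<rbrakk> \<Longrightarrow> dist (\<sigma> s) (\<sigma> \<tau>) < c"
    using abs_cont_on_continuous[OF \<sigma>] \<tau>(1) \<open>0 < c\<close> unfolding continuous_on_iff by metis
  \<comment> \<open>A time before \<open>\<tau>\<close> that is positive and closer to \<open>\<tau>\<close> than \<open>d\<close>.\<close>
  define s where "s = max (\<tau> / 2) (\<tau> - d / 2)"
  have "0 < s" "s < \<tau>" "dist s \<tau> < d"
    using \<open>0 < \<tau>\<close> \<open>0 < d\<close> by (auto simp: s_def dist_real_def)
  then show False
    using d(2)[of s] lower[of s] \<tau> by (auto simp: dist_real_def)
qed

text \<open>Calibration by a coordinate adapted to the semicircle \<open>x\<^sup>2 + \<sigma>\<^sup>2 = R\<^sup>2\<close>, where \<open>x\<close> is the coordinate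
  of \<open>m\<close> along the unit vector \<open>e\<close>, measured from the centre. Writing
  \<open>x = r * tanh s\<close> and \<open>\<sigma> = r / cosh s\<close> one has \<open>sinh s = x / \<sigma>\<close>, and Lagrange's identity
  \<open>(x'\<^sup>2 + \<sigma>'\<^sup>2) * (x\<^sup>2 + \<sigma>\<^sup>2) = (x' * \<sigma> - x * \<sigma>')\<^sup>2 + (x * x' + \<sigma> * \<sigma>')\<^sup>2\<close>
  yields \<open>(x'\<^sup>2 + \<sigma>'\<^sup>2) / \<sigma>\<^sup>2 = s'\<^sup>2 + (x * x' + \<sigma> * \<sigma>')\<^sup>2 / (\<sigma>\<^sup>2 * r\<^sup>2)\<close>. The second summand is, up to a
  positive factor, the squared derivative of \<open>r\<^sup>2\<close>; the motion of \<open>m\<close> orthogonal to \<open>e\<close> adds a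
  further nonnegative term. In the case of equality \<open>s\<close> is affine, \<open>r\<close> is constant, and \<open>m\<close> moves
  only along \<open>e\<close>.\<close>

lemma hyperbolic_energy_bound:
  fixes m :: "real \<Rightarrow> 'a::euclidean_space" and \<sigma> :: "real \<Rightarrow> real" and e p :: 'a and c :: real
  defines "x \<equiv> \<lambda>t. (m t - p) \<bullet> e - c"
  defines "s \<equiv> \<lambda>t. arsinh (x t / \<sigma> t)"
  assumes m: "abs_cont_on 0 1 m" and \<sigma>: "abs_cont_on 0 1 \<sigma>"
    and pos: "\<And>t. t \<in> {0..1} \<Longrightarrow> 0 < \<sigma> t" and e: "norm e = 1"
  shows "ennreal ((s 1 - s 0)\<^sup>2 / 2) \<le> action m \<sigma>"
    and "\<lbrakk>action m \<sigma> = ennreal ((s 1 - s 0)\<^sup>2 / 2); t \<in> {0..1}\<rbrakk>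
      \<Longrightarrow> s t = s 0 + t * (s 1 - s 0) \<and> (x t)\<^sup>2 + (\<sigma> t)\<^sup>2 = (x 0)\<^sup>2 + (\<sigma> 0)\<^sup>2
        \<and> m t - (m t \<bullet> e) *\<^sub>R e = m 0 - (m 0 \<bullet> e) *\<^sub>R e"
proof -
  let ?m' = "\<lambda>t. vector_derivative m (at t within {0..1})"
  let ?\<sigma>' = "\<lambda>t. vector_derivative \<sigma> (at t within {0..1})"
  define x' where "x' t = ?m' t \<bullet> e" for t
  define r2 where "r2 t = (x t)\<^sup>2 + (\<sigma> t)\<^sup>2" for t
  define w where "w t = (x' t * \<sigma> t - x t * ?\<sigma>' t) / (\<sigma> t * sqrt (r2 t))" for t
  define \<rho> where "\<rho> t = (x t * x' t + \<sigma> t * ?\<sigma>' t)\<^sup>2 / ((\<sigma> t)\<^sup>2 * r2 t)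
      + (norm (?m' t - x' t *\<^sub>R e))\<^sup>2 / (\<sigma> t)\<^sup>2" for t
  obtain Nm where Nm: "negligible Nm" "\<And>t. t \<in> {0..1} - Nm \<Longrightarrow> (m has_vector_derivative ?m' t) (at t)"
    using abs_cont_on_vector_derivative[OF m] by metis
  obtain Ns where Ns: "negligible Ns" "\<And>t. t \<in> {0..1} - Ns \<Longrightarrow> (\<sigma> has_vector_derivative ?\<sigma>' t) (at t)"
    using abs_cont_on_vector_derivative[OF \<sigma>] by metis
  define N where "N = Nm \<union> Ns"
  have N: "negligible N"
    using Nm Ns by (simp add: N_def)
  have r2: "0 < r2 t" if "t \<in> {0..1}" for t
    using pos[OF that] by (simp add: r2_def add_nonneg_pos)
  have dm: "(m has_vector_derivative ?m' t) (at t)" and d\<sigma>: "(\<sigma> has_real_derivative ?\<sigma>' t) (at t)"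
    and dx: "(x has_real_derivative x' t) (at t)" if "t \<in> {0..1} - N" for t
  proof -
    show dm: "(m has_vector_derivative ?m' t) (at t)" and "(\<sigma> has_real_derivative ?\<sigma>' t) (at t)"
      using Nm(2)[of t] Ns(2)[of t] that by (auto simp: N_def has_real_derivative_iff_has_vector_derivative)
    have "((\<lambda>t. (m t - p) \<bullet> e) has_vector_derivative (?m' t - 0) \<bullet> e) (at t)"
      by (intro bounded_linear.has_vector_derivative[OF bounded_linear_inner_left]
          has_vector_derivative_diff has_vector_derivative_const dm)
    then have "(x has_vector_derivative x' t - 0) (at t)"
      unfolding x_def x'_def by (intro has_vector_derivative_diff has_vector_derivative_const) simp
    then show "(x has_real_derivative x' t) (at t)"
      by (simp add: has_real_derivative_iff_has_vector_derivative)
  qed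
  have acx: "abs_cont_on 0 1 x"
  proof (rule abs_cont_on_compose_lipschitz[OF m, where L = 1])
    show "norm (x t - x s) \<le> 1 * norm (m t - m s)" for s t
      using Cauchy_Schwarz_ineq2[of "m t - m s" e] e by (simp add: x_def inner_diff_left)
  qed
  obtain \<delta> where \<delta>: "0 < \<delta>" "\<And>t. t \<in> {0..1} \<Longrightarrow> \<delta> \<le> \<sigma> t"
    using positive_lower_bound[OF \<sigma> pos] by metis
  have acs: "abs_cont_on 0 1 s"
    unfolding s_def divide_inverse
    by (intro abs_cont_on_arsinh abs_cont_on_mult acx abs_cont_on_inverse[OF \<sigma> \<delta>])
  have ds: "(s has_vector_derivative w t) (at t within {0..1})" if "t \<in> {0..1} - N" for t
  proof -
    have "0 < \<sigma> t"
      using pos that by simp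
    have "((\<lambda>t. x t / \<sigma> t) has_real_derivative (x' t * \<sigma> t - x t * ?\<sigma>' t) / (\<sigma> t * \<sigma> t)) (at t)"
      using dx[OF that] d\<sigma>[OF that] \<open>0 < \<sigma> t\<close> by (intro DERIV_divide) auto
    from DERIV_chain2[OF arsinh_real_has_field_derivative this]
    have "(s has_real_derivative 1 / sqrt ((x t / \<sigma> t)\<^sup>2 + 1) * ((x' t * \<sigma> t - x t * ?\<sigma>' t) / (\<sigma> t * \<sigma> t))) (at t)"
      unfolding s_def .
    moreover have "sqrt ((x t / \<sigma> t)\<^sup>2 + 1) = sqrt (r2 t) / \<sigma> t"
    proof -
      have "(x t / \<sigma> t)\<^sup>2 + 1 = r2 t / (\<sigma> t)\<^sup>2"
        using \<open>0 < \<sigma> t\<close> by (simp add: r2_def power_divide add_divide_distrib)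
      then show ?thesis
        using \<open>0 < \<sigma> t\<close> by (simp add: real_sqrt_divide)
    qed
    ultimately have "(s has_real_derivative w t) (at t)"
      using \<open>0 < \<sigma> t\<close> by (simp add: w_def mult.commute)
    then show ?thesis
      by (auto simp: has_real_derivative_iff_has_vector_derivative intro: has_vector_derivative_at_within)
  qed
  have \<rho>_meas: "\<rho> \<in> borel_measurable (lebesgue_on {0..1})"
  proof -
    have [measurable]: "x \<in> borel_measurable (lebesgue_on {0..1})" "\<sigma> \<in> borel_measurable (lebesgue_on {0..1})"
      "?m' \<in> borel_measurable (lebesgue_on {0..1})" "?\<sigma>' \<in> borel_measurable (lebesgue_on {0..1})"
      using abs_cont_on_measurable[OF acx] abs_cont_on_measurable[OF \<sigma>]
        derivative_measurable_subinterval[OF m order_refl] derivative_measurable_subinterval[OF \<sigma> order_refl] .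
    show ?thesis
      unfolding \<rho>_def r2_def x'_def by measurable
  qed
  have \<rho>_nonneg: "0 \<le> \<rho> t" for t
    by (simp add: \<rho>_def r2_def)
  have density: "action_density m \<sigma> t = ennreal (((w t)\<^sup>2 + \<rho> t) / 2)" if "t \<in> {0..1} - N" for t
  proof -
    have "0 < \<sigma> t" "0 < r2 t"
      using pos r2 that by auto
    \<comment> \<open>Pythagoras for the component of \<open>m'\<close> along \<open>e\<close>.\<close>
    have pyth: "(norm (?m' t))\<^sup>2 = (x' t)\<^sup>2 + (norm (?m' t - x' t *\<^sub>R e))\<^sup>2"
      using e unfolding power2_norm_eq_inner x'_def
      by (simp add: inner_diff_left inner_diff_right inner_commute power2_eq_square norm_eq_1)
    have "(x' t * \<sigma> t - x t * ?\<sigma>' t)\<^sup>2 + (x t * x' t + \<sigma> t * ?\<sigma>' t)\<^sup>2 = ((x' t)\<^sup>2 + (?\<sigma>' t)\<^sup>2) * r2 t"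
      by (simp add: r2_def power2_eq_square algebra_simps)
    moreover have "(w t)\<^sup>2 = (x' t * \<sigma> t - x t * ?\<sigma>' t)\<^sup>2 / ((\<sigma> t)\<^sup>2 * r2 t)"
      using \<open>0 < r2 t\<close> by (simp add: w_def power_divide power_mult_distrib)
    ultimately have "(w t)\<^sup>2 + (x t * x' t + \<sigma> t * ?\<sigma>' t)\<^sup>2 / ((\<sigma> t)\<^sup>2 * r2 t) = ((x' t)\<^sup>2 + (?\<sigma>' t)\<^sup>2) / (\<sigma> t)\<^sup>2"
      using \<open>0 < r2 t\<close> by (simp add: add_divide_distrib[symmetric])
    then have "((norm (?m' t))\<^sup>2 + (?\<sigma>' t)\<^sup>2) / (\<sigma> t)\<^sup>2 = (w t)\<^sup>2 + \<rho> t"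
      unfolding \<rho>_def pyth by (simp add: add_divide_distrib)
    then show ?thesis
      using action_density_positive[where \<sigma> = \<sigma> and t = t and m = m, OF \<open>0 < \<sigma> t\<close>] by (simp only:)
  qed
  note bound = energy_bound[where e = "action_density m \<sigma>", OF zero_less_one acs N ds \<rho>_meas \<rho>_nonneg density,
      folded action_def, unfolded diff_zero mult_1_right div_by_1]
  show "ennreal ((s 1 - s 0)\<^sup>2 / 2) \<le> action m \<sigma>"
    by (rule bound(1))
  show "s t = s 0 + t * (s 1 - s 0) \<and> (x t)\<^sup>2 + (\<sigma> t)\<^sup>2 = (x 0)\<^sup>2 + (\<sigma> 0)\<^sup>2
        \<and> m t - (m t \<bullet> e) *\<^sub>R e = m 0 - (m 0 \<bullet> e) *\<^sub>R e"
    if opt: "action m \<sigma> = ennreal ((s 1 - s 0)\<^sup>2 / 2)" and t: "t \<in> {0..1}"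
  proof (intro conjI)
    show "s t = s 0 + t * (s 1 - s 0)"
      by (rule bound(2)[OF _ _ opt t])
    have "negligible {t \<in> {0..1}. \<rho> t \<noteq> 0}"
      by (rule bound(3)[OF _ _ opt])
    define N' where "N' = N \<union> {t \<in> {0..1}. \<rho> t \<noteq> 0}"
    have N': "negligible N'"
      using \<open>negligible {t \<in> {0..1}. \<rho> t \<noteq> 0}\<close> N by (simp add: N'_def)
    have zero: "x t * x' t + \<sigma> t * ?\<sigma>' t = 0" "?m' t = x' t *\<^sub>R e" if "t \<in> {0..1} - N'" for t
    proof -
      have "0 < \<sigma> t" "0 < r2 t" "\<rho> t = 0"
        using pos r2 that by (auto simp: N'_def)
      then have "(x t * x' t + \<sigma> t * ?\<sigma>' t)\<^sup>2 / ((\<sigma> t)\<^sup>2 * r2 t) = 0"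
        "(norm (?m' t - x' t *\<^sub>R e))\<^sup>2 / (\<sigma> t)\<^sup>2 = 0"
        unfolding \<rho>_def by (simp_all only: add_nonneg_eq_0_iff divide_nonneg_pos divide_nonneg_nonneg
            zero_le_power2 mult_nonneg_nonneg less_imp_le)
      then show "x t * x' t + \<sigma> t * ?\<sigma>' t = 0" "?m' t = x' t *\<^sub>R e"
        using \<open>0 < \<sigma> t\<close> \<open>0 < r2 t\<close> by auto
    qed
    have "r2 t = r2 0"
    proof (rule abs_cont_on_constant[OF _ N' _ t])
      show "abs_cont_on 0 1 r2"
        unfolding r2_def power2_eq_square by (intro abs_cont_on_add abs_cont_on_mult acx \<sigma>)
      fix t assume t: "t \<in> {0..1} - N'"
      then have "t \<in> {0..1} - N"
        by (auto simp: N'_def)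
      then have "(r2 has_real_derivative (2 * x t * x' t + 2 * \<sigma> t * ?\<sigma>' t)) (at t)"
        unfolding r2_def by (auto intro!: derivative_eq_intros dx d\<sigma>)
      moreover have "2 * x t * x' t + 2 * \<sigma> t * ?\<sigma>' t = 0"
        using zero(1)[OF t] by simp
      ultimately show "(r2 has_vector_derivative 0) (at t)"
        by (simp add: has_real_derivative_iff_has_vector_derivative)
    qed
    then show "(x t)\<^sup>2 + (\<sigma> t)\<^sup>2 = (x 0)\<^sup>2 + (\<sigma> 0)\<^sup>2"
      by (simp add: r2_def)
    show "m t - (m t \<bullet> e) *\<^sub>R e = m 0 - (m 0 \<bullet> e) *\<^sub>R e"
    proof (rule abs_cont_on_constant[OF _ N' _ t])
      show "abs_cont_on 0 1 (\<lambda>t. m t - (m t \<bullet> e) *\<^sub>R e)"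
      proof (rule abs_cont_on_compose_lipschitz[OF m, where L = 2])
        fix s t
        have "norm ((m t - (m t \<bullet> e) *\<^sub>R e) - (m s - (m s \<bullet> e) *\<^sub>R e)) = norm ((m t - m s) - ((m t - m s) \<bullet> e) *\<^sub>R e)"
          by (simp add: inner_diff_left algebra_simps)
        also have "\<dots> \<le> norm (m t - m s) + norm (((m t - m s) \<bullet> e) *\<^sub>R e)"
          by (rule norm_triangle_ineq4)
        also have "\<dots> \<le> 2 * norm (m t - m s)"
          using Cauchy_Schwarz_ineq2[of "m t - m s" e] e by simp
        finally show "norm ((m t - (m t \<bullet> e) *\<^sub>R e) - (m s - (m s \<bullet> e) *\<^sub>R e)) \<le> 2 * norm (m t - m s)" .
      qed
      fix t assume t: "t \<in> {0..1} - N'"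
      then have "t \<in> {0..1} - N"
        by (auto simp: N'_def)
      have "((\<lambda>t. m t - (m t \<bullet> e) *\<^sub>R e) has_vector_derivative ?m' t - x' t *\<^sub>R e) (at t)"
        unfolding x'_def
        by (intro has_vector_derivative_diff dm[OF \<open>t \<in> {0..1} - N\<close>]
            bounded_linear.has_vector_derivative[OF bounded_linear_scaleR_left]
            bounded_linear.has_vector_derivative[OF bounded_linear_inner_left])
      then show "((\<lambda>t. m t - (m t \<bullet> e) *\<^sub>R e) has_vector_derivative 0) (at t)"
        using zero(2)[OF t] by simp
    qed
  qed
qed

section \<open>Optimal curves\<close>

lemma constant_speed_action:
  fixes m :: "real \<Rightarrow> 'a::euclidean_space" and \<sigma> :: "real \<Rightarrow> real"
  assumes m: "\<And>t. t \<in> {0..1} \<Longrightarrow> (m has_vector_derivative m' t) (at t within {0..1})" "continuous_on {0..1} m'"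
    and \<sigma>: "\<And>t. t \<in> {0..1} \<Longrightarrow> (\<sigma> has_vector_derivative \<sigma>' t) (at t within {0..1})" "continuous_on {0..1} \<sigma>'"
    and pos: "\<And>t. t \<in> {0..1} \<Longrightarrow> 0 < \<sigma> t"
    and speed: "\<And>t. t \<in> {0..1} \<Longrightarrow> (norm (m' t))\<^sup>2 + (\<sigma>' t)\<^sup>2 = k * (\<sigma> t)\<^sup>2"
  shows "abs_cont_on 0 1 m" "abs_cont_on 0 1 \<sigma>" "action m \<sigma> = ennreal (k / 2)"
proof -
  show "abs_cont_on 0 1 m" "abs_cont_on 0 1 \<sigma>"
    using abs_cont_on_C1[OF m] abs_cont_on_C1[OF \<sigma>] by auto
  have density: "action_density m \<sigma> t = ennreal (k / 2)" if t: "t \<in> {0..1}" for t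
  proof -
    have "vector_derivative m (at t within {0..1}) = m' t" "vector_derivative \<sigma> (at t within {0..1}) = \<sigma>' t"
      using vector_derivative_within_cbox[of 0 1 t m "m' t"] vector_derivative_within_cbox[of 0 1 t \<sigma> "\<sigma>' t"]
        m(1)[OF t] \<sigma>(1)[OF t] t by simp_all
    with action_density_positive[where \<sigma> = \<sigma> and t = t and m = m, OF pos[OF t]] show ?thesis
      using speed[OF t] pos[OF t] by simp
  qed
  have "action m \<sigma> = (\<integral>\<^sup>+t\<in>{0..1::real}. ennreal (k / 2) \<partial>lborel)"
    unfolding action_def using density by (intro set_nn_integral_cong) auto
  also have "\<dots> = ennreal (k / 2)"
    by (simp add: nn_integral_cmult_indicator)
  finally show "action m \<sigma> = ennreal (k / 2)" .
qed

text \<open>Geometrically, \<open>arsinh (x / y)\<close> is the hyperbolic arc length from the top of the semicircle of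
  radius \<open>r\<close> to its point at horizontal offset \<open>x\<close> and height \<open>y\<close>. The logarithmic form leads to
  the formulas for the distance and for \<open>t0\<close>, the other two to the explicit curve.\<close>

lemma arsinh_quotient:
  fixes x y r :: real
  assumes "0 < y" "0 \<le> r" "r\<^sup>2 = x\<^sup>2 + y\<^sup>2"
  shows "arsinh (x / y) = ln ((x + r) / y)" "cosh (arsinh (x / y)) = r / y" "tanh (arsinh (x / y)) = x / r"
proof -
  have "(x / y)\<^sup>2 + 1 = (r / y)\<^sup>2"
    using assms by (simp add: power_divide add_divide_distrib)
  then have root: "sqrt ((x / y)\<^sup>2 + 1) = r / y"
    using assms by simp
  then show "arsinh (x / y) = ln ((x + r) / y)"
    by (simp add: arsinh_real_def add_divide_distrib)
  show cosh: "cosh (arsinh (x / y)) = r / y"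
    by (simp add: cosh_arsinh_real root)
  show "tanh (arsinh (x / y)) = x / r"
    using assms(1) by (simp add: tanh_def cosh)
qed

text \<open>The points \<open>(0, \<sigma>0)\<close> and \<open>(n, \<sigma>1)\<close> of the half plane lie on a unique semicircle centred on the
  boundary; \<open>c\<close> is its centre and \<open>R\<close> its radius. The square root in the theorem is \<open>2 * n * R\<close>, and
  with this the two logarithms become the parameter \<open>t0\<close> of the first point and the difference of
  the parameters of both points. The first point lies on the descending half of the semicircle,
  \<open>c \<le> 0\<close>, exactly if \<open>t0 \<ge> 0\<close>.\<close>

lemma semicircle_parameters:
  fixes n \<sigma>0 \<sigma>1 c R :: real
  assumes "0 < n" "0 < \<sigma>0" "0 < \<sigma>1"
    and c: "c = (n\<^sup>2 + \<sigma>1\<^sup>2 - \<sigma>0\<^sup>2) / (2 * n)" and R: "R = sqrt (c\<^sup>2 + \<sigma>0\<^sup>2)"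
  shows "0 < R" "R\<^sup>2 = c\<^sup>2 + \<sigma>0\<^sup>2" "R\<^sup>2 = (n - c)\<^sup>2 + \<sigma>1\<^sup>2"
    and "ln ((\<sigma>0\<^sup>2 - \<sigma>1\<^sup>2 - n\<^sup>2 + sqrt ((n\<^sup>2 + \<sigma>0\<^sup>2 + \<sigma>1\<^sup>2)\<^sup>2 - 4 * \<sigma>0\<^sup>2 * \<sigma>1\<^sup>2)) / (2 * n * \<sigma>0)) = arsinh (- c / \<sigma>0)"
    and "0 \<le> arsinh (- c / \<sigma>0) \<longleftrightarrow> n\<^sup>2 + \<sigma>1\<^sup>2 \<le> \<sigma>0\<^sup>2"
    and "arsinh ((n - c) / \<sigma>1) - arsinh (- c / \<sigma>0) = \<bar>ln ((n\<^sup>2 + \<sigma>0\<^sup>2 + \<sigma>1\<^sup>2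
             - sqrt ((n\<^sup>2 + \<sigma>0\<^sup>2 + \<sigma>1\<^sup>2)\<^sup>2 - 4 * \<sigma>0\<^sup>2 * \<sigma>1\<^sup>2)) / (2 * \<sigma>0 * \<sigma>1))\<bar>"
    and "0 < arsinh ((n - c) / \<sigma>1) - arsinh (- c / \<sigma>0)"
proof -
  define A where "A = n\<^sup>2 + \<sigma>0\<^sup>2 + \<sigma>1\<^sup>2"
  define S where "S = 2 * n * R"
  have nc: "2 * n * c = n\<^sup>2 + \<sigma>1\<^sup>2 - \<sigma>0\<^sup>2"
    using \<open>0 < n\<close> by (simp add: c)
  show "0 < R" and R2: "R\<^sup>2 = c\<^sup>2 + \<sigma>0\<^sup>2"
    using \<open>0 < \<sigma>0\<close> by (auto simp: R add_nonneg_pos)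
  then have "0 < R" by simp
  show R2': "R\<^sup>2 = (n - c)\<^sup>2 + \<sigma>1\<^sup>2"
    using R2 nc by (simp add: power2_eq_square algebra_simps)
  have "\<bar>c\<bar> < R"
  proof (rule power2_less_imp_less)
    show "\<bar>c\<bar>\<^sup>2 < R\<^sup>2"
      unfolding R2 using \<open>0 < \<sigma>0\<close> by simp
  qed (use \<open>0 < R\<close> in simp)
  have "\<bar>n - c\<bar> < R"
  proof (rule power2_less_imp_less)
    show "\<bar>n - c\<bar>\<^sup>2 < R\<^sup>2"
      unfolding R2' using \<open>0 < \<sigma>1\<close> by simp
  qed (use \<open>0 < R\<close> in simp)
  have "0 < S"
    using \<open>0 < n\<close> \<open>0 < R\<close> by (simp add: S_def)
  have S2: "S\<^sup>2 = A\<^sup>2 - 4 * \<sigma>0\<^sup>2 * \<sigma>1\<^sup>2"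
  proof -
    have "S\<^sup>2 = (2 * n * c)\<^sup>2 + 4 * n\<^sup>2 * \<sigma>0\<^sup>2"
      by (simp add: S_def power_mult_distrib R2 algebra_simps)
    also have "\<dots> = A\<^sup>2 - 4 * \<sigma>0\<^sup>2 * \<sigma>1\<^sup>2"
      unfolding nc A_def by (simp add: power2_eq_square algebra_simps)
    finally show ?thesis .
  qed
  then have root: "sqrt ((n\<^sup>2 + \<sigma>0\<^sup>2 + \<sigma>1\<^sup>2)\<^sup>2 - 4 * \<sigma>0\<^sup>2 * \<sigma>1\<^sup>2) = S"
    using \<open>0 < S\<close> by (intro real_sqrt_unique) (auto simp: A_def)
  have t0: "arsinh (- c / \<sigma>0) = ln ((- c + R) / \<sigma>0)"
    by (rule arsinh_quotient(1)) (simp_all add: R2 \<open>0 < \<sigma>0\<close> less_imp_le[OF \<open>0 < R\<close>])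
  have s1: "arsinh ((n - c) / \<sigma>1) = ln ((n - c + R) / \<sigma>1)"
    by (rule arsinh_quotient(1)) (simp_all add: R2' \<open>0 < \<sigma>1\<close> less_imp_le[OF \<open>0 < R\<close>])
  have "\<sigma>0\<^sup>2 - \<sigma>1\<^sup>2 - n\<^sup>2 + S = 2 * n * (- c + R)"
    using nc by (simp add: S_def algebra_simps)
  then show "ln ((\<sigma>0\<^sup>2 - \<sigma>1\<^sup>2 - n\<^sup>2 + sqrt ((n\<^sup>2 + \<sigma>0\<^sup>2 + \<sigma>1\<^sup>2)\<^sup>2 - 4 * \<sigma>0\<^sup>2 * \<sigma>1\<^sup>2)) / (2 * n * \<sigma>0)) = arsinh (- c / \<sigma>0)"
    unfolding root t0 using \<open>0 < n\<close> by simp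
  have "c \<le> 0 \<longleftrightarrow> n\<^sup>2 + \<sigma>1\<^sup>2 \<le> \<sigma>0\<^sup>2"
    using \<open>0 < n\<close> by (simp add: c divide_le_0_iff)
  moreover have "0 \<le> arsinh (- c / \<sigma>0) \<longleftrightarrow> c \<le> 0"
    using \<open>0 < \<sigma>0\<close> by (simp add: not_less[symmetric] zero_less_divide_iff)
  ultimately show "0 \<le> arsinh (- c / \<sigma>0) \<longleftrightarrow> n\<^sup>2 + \<sigma>1\<^sup>2 \<le> \<sigma>0\<^sup>2"
    by simp
  \<comment> \<open>\<open>P\<close> is the reciprocal of the argument of the logarithm in the distance formula.\<close>
  define P where "P = (A + S) / (2 * \<sigma>0 * \<sigma>1)"
  have "2 * \<sigma>0 * \<sigma>1 \<le> A"
    using sum_squares_bound[of \<sigma>0 \<sigma>1] zero_le_power2[of n] unfolding A_def by linarith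
  then have "1 < P"
    using \<open>0 < S\<close> \<open>0 < \<sigma>0\<close> \<open>0 < \<sigma>1\<close> by (simp add: P_def)
  have diff: "arsinh ((n - c) / \<sigma>1) - arsinh (- c / \<sigma>0) = ln P"
  proof -
    have pos: "0 < (n - c + R) / \<sigma>1" "0 < (- c + R) / \<sigma>0"
      using \<open>\<bar>n - c\<bar> < R\<close> \<open>\<bar>c\<bar> < R\<close> \<open>0 < \<sigma>0\<close> \<open>0 < \<sigma>1\<close> by auto
    have "(A + S) * (- c + R) = 2 * \<sigma>0\<^sup>2 * (n - c + R)"
    proof -
      have "A + S = 2 * (n * (R + c) + \<sigma>0\<^sup>2)"
        using nc by (simp add: A_def S_def algebra_simps)
      then have "(A + S) * (- c + R) = 2 * (n * (R\<^sup>2 - c\<^sup>2) + \<sigma>0\<^sup>2 * (- c + R))"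
        by (simp add: power2_eq_square algebra_simps)
      also have "\<dots> = 2 * \<sigma>0\<^sup>2 * (n - c + R)"
        unfolding R2 by (simp add: algebra_simps)
      finally show ?thesis .
    qed
    then have "(n - c + R) / \<sigma>1 = P * ((- c + R) / \<sigma>0)"
    proof -
      have "P * ((- c + R) / \<sigma>0) = ((A + S) * (- c + R)) / (2 * \<sigma>0\<^sup>2 * \<sigma>1)"
        by (simp add: P_def power2_eq_square mult.assoc mult.left_commute)
      also have "\<dots> = (n - c + R) / \<sigma>1"
        unfolding \<open>(A + S) * (- c + R) = _\<close> using \<open>0 < \<sigma>0\<close> by simp
      finally show ?thesis by simp
    qed
    then have "ln ((n - c + R) / \<sigma>1) = ln P + ln ((- c + R) / \<sigma>0)"
    proof (simp only:)
      show "ln (P * ((- c + R) / \<sigma>0)) = ln P + ln ((- c + R) / \<sigma>0)"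
        using pos(2) \<open>1 < P\<close> by (intro ln_mult_pos) auto
    qed
    then show ?thesis
      unfolding s1 t0 by simp
  qed
  show "0 < arsinh ((n - c) / \<sigma>1) - arsinh (- c / \<sigma>0)"
    unfolding diff using \<open>1 < P\<close> by simp
  have "P * ((A - S) / (2 * \<sigma>0 * \<sigma>1)) = 1"
  proof -
    have "(A + S) * (A - S) = (2 * \<sigma>0 * \<sigma>1) * (2 * \<sigma>0 * \<sigma>1)"
    proof -
      have "(A + S) * (A - S) = A\<^sup>2 - S\<^sup>2"
        by (simp add: power2_eq_square algebra_simps)
      then show ?thesis
        unfolding S2 by (simp add: power2_eq_square)
    qed
    then show ?thesis
      using \<open>0 < \<sigma>0\<close> \<open>0 < \<sigma>1\<close> by (simp only: P_def times_divide_times_eq) simp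
  qed
  then have "(A - S) / (2 * \<sigma>0 * \<sigma>1) = inverse P"
    by (rule inverse_unique[symmetric])
  then have "ln ((A - S) / (2 * \<sigma>0 * \<sigma>1)) = - ln P"
    using \<open>1 < P\<close> by (simp add: ln_inverse)
  then show "arsinh ((n - c) / \<sigma>1) - arsinh (- c / \<sigma>0) = \<bar>ln ((n\<^sup>2 + \<sigma>0\<^sup>2 + \<sigma>1\<^sup>2
             - sqrt ((n\<^sup>2 + \<sigma>0\<^sup>2 + \<sigma>1\<^sup>2)\<^sup>2 - 4 * \<sigma>0\<^sup>2 * \<sigma>1\<^sup>2)) / (2 * \<sigma>0 * \<sigma>1))\<bar>"
    unfolding diff root unfolding A_def[symmetric] using \<open>1 < P\<close> by simp
qed

lemma Dvar_sq_eqI: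
  assumes "\<And>m \<sigma>. admissible \<mu>0 \<mu>1 m \<sigma> \<Longrightarrow> V \<le> action m \<sigma>"
    and "admissible \<mu>0 \<mu>1 m \<sigma>" "action m \<sigma> = V"
  shows "Dvar_sq \<mu>0 \<mu>1 = V"
  unfolding Dvar_sq_def
proof (rule order_antisym)
  show "(INF (m, \<sigma>)\<in>{(m, \<sigma>). admissible \<mu>0 \<mu>1 m \<sigma>}. action m \<sigma>) \<le> V"
    using assms(2,3) by (intro INF_lower2[of "(m, \<sigma>)"]) auto
  show "V \<le> (INF (m, \<sigma>)\<in>{(m, \<sigma>). admissible \<mu>0 \<mu>1 m \<sigma>}. action m \<sigma>)"
    using assms(1) by (intro INF_greatest) auto
qed

lemma admissible_boundary:
  assumes "admissible \<mu>0 \<mu>1 m \<sigma>" "0 < \<sigma>0" "\<sigma>0\<^sup>2 = var \<mu>0" "0 < \<sigma>1" "\<sigma>1\<^sup>2 = var \<mu>1"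
  shows "\<sigma> 0 = \<sigma>0" "\<sigma> 1 = \<sigma>1"
proof -
  have "(\<sigma> 0)\<^sup>2 = \<sigma>0\<^sup>2" "(\<sigma> 1)\<^sup>2 = \<sigma>1\<^sup>2" "0 \<le> \<sigma> 0" "0 \<le> \<sigma> 1"
    using assms(1) unfolding admissible_def assms(3,5) by auto
  then show "\<sigma> 0 = \<sigma>0" "\<sigma> 1 = \<sigma>1"
    using assms(2,4) power2_eq_imp_eq less_imp_le by blast+
qed

lemma optimal_positive:
  assumes "admissible \<mu>0 \<mu>1 m \<sigma>" "0 < \<sigma> 0" "action m \<sigma> < \<infinity>" "t \<in> {0..1}"
  shows "0 < \<sigma> t"
proof (rule finite_action_imp_positive[OF _ _ assms(2) _ assms(3,4)])
  show "abs_cont_on 0 1 m" "abs_cont_on 0 1 \<sigma>"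
    using assms(1) by (simp_all add: admissible_def)
  show "0 \<le> \<sigma> s" if "s \<in> {0..1}" for s
    using assms(1) that unfolding admissible_def by blast
qed

text \<open>The semicircle at constant speed has action \<open>d\<^sup>2 / 2\<close>, where \<open>d\<close> is the difference of the
  arc-length parameters of the endpoints. The calibration by \<open>s\<close> gives the same lower bound for
  every competitor, and its equality case leaves only this curve.\<close>

lemma semicircle_optimal:
  fixes \<mu>0 \<mu>1 :: "'a::euclidean_space measure" and c R d t0 :: real
  assumes mean: "m0 = mean \<mu>0" "m1 = mean \<mu>1" and n: "n = norm (m1 - m0)" "0 < n"
    and var: "0 < \<sigma>0" "\<sigma>0\<^sup>2 = var \<mu>0" "0 < \<sigma>1" "\<sigma>1\<^sup>2 = var \<mu>1"
    and R: "0 < R" "R\<^sup>2 = c\<^sup>2 + \<sigma>0\<^sup>2" "R\<^sup>2 = (n - c)\<^sup>2 + \<sigma>1\<^sup>2"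
    and t0: "t0 = arsinh (- c / \<sigma>0)" and d: "d = arsinh ((n - c) / \<sigma>1) - t0"
  shows "Dvar_sq \<mu>0 \<mu>1 = ennreal (d\<^sup>2 / 2)"
    and "optimal_curve \<mu>0 \<mu>1 m \<sigma> \<longleftrightarrow>
      (\<forall>t\<in>{0..1}. m t = m0 + ((tanh (d * t + t0) - tanh t0) / (tanh (d + t0) - tanh t0)) *\<^sub>R (m1 - m0)
         \<and> \<sigma> t = n / (tanh (d + t0) - tanh t0) * (1 / cosh (d * t + t0)))"
proof -
  define K where "K = tanh (d + t0) - tanh t0"
  define M where "M t = m0 + ((tanh (d * t + t0) - tanh t0) / K) *\<^sub>R (m1 - m0)" for t
  define \<Sigma> where "\<Sigma> t = n / K * (1 / cosh (d * t + t0))" for t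
  have start: "tanh t0 = - c / R" "cosh t0 = R / \<sigma>0"
    using arsinh_quotient(2,3)[of \<sigma>0 R "- c", OF var(1) less_imp_le[OF R(1)]] by (simp_all add: t0 R(2))
  have finish: "tanh (d + t0) = (n - c) / R" "cosh (d + t0) = R / \<sigma>1"
    using arsinh_quotient(2,3)[of \<sigma>1 R "n - c", OF var(3) less_imp_le[OF R(1)]] by (simp_all add: d R(3))
  have K: "K = n / R"
    unfolding K_def start finish by (simp add: diff_divide_distrib)
  have nK: "n / K = R" "K \<noteq> 0"
    using n(2) R(1) by (auto simp: K)
  define e where "e = (1 / n) *\<^sub>R (m1 - m0)"
  have e: "norm e = 1" "m1 - m0 = n *\<^sub>R e" "(m1 - m0) \<bullet> e = n"
  proof -
    show "norm e = 1" "m1 - m0 = n *\<^sub>R e"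
      using n by (simp_all add: e_def)
    then show "(m1 - m0) \<bullet> e = n"
      by (simp add: norm_eq_1)
  qed
  have curve: "admissible \<mu>0 \<mu>1 m \<sigma> \<and> action m \<sigma> = ennreal (d\<^sup>2 / 2)"
    if eq: "\<And>t. t \<in> {0..1} \<Longrightarrow> m t = M t \<and> \<sigma> t = \<Sigma> t" for m \<sigma>
  proof -
    define M' where "M' t = (d * (1 - (tanh (d * t + t0))\<^sup>2) / K) *\<^sub>R (m1 - m0)" for t
    define \<Sigma>' where "\<Sigma>' t = - R * d * tanh (d * t + t0) / cosh (d * t + t0)" for t
    have ddM: "(M has_vector_derivative M' t) (at t within {0..1})" for t
    proof -
      have "((\<lambda>t. (tanh (d * t + t0) - tanh t0) / K) has_real_derivative d * (1 - (tanh (d * t + t0))\<^sup>2) / K) (at t within {0..1})"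
        using nK(2) by (auto intro!: derivative_eq_intros)
      then have "((\<lambda>t. m0 + ((tanh (d * t + t0) - tanh t0) / K) *\<^sub>R (m1 - m0)) has_vector_derivative 
          0 + ((((tanh (d * t + t0) - tanh t0) / K) *\<^sub>R 0) + (d * (1 - (tanh (d * t + t0))\<^sup>2) / K) *\<^sub>R (m1 - m0))) (at t within {0..1})"
        by (intro has_vector_derivative_add has_vector_derivative_scaleR has_vector_derivative_const)
      then show ?thesis
        unfolding M_def M'_def by simp
    qed
    have dd\<Sigma>: "(\<Sigma> has_vector_derivative \<Sigma>' t) (at t within {0..1})" for t
    proof -
      have "((\<lambda>t. R * (1 / cosh (d * t + t0))) has_real_derivative \<Sigma>' t) (at t within {0..1})"
        unfolding \<Sigma>'_def by (auto intro!: derivative_eq_intros simp: tanh_def power2_eq_square)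
      then show ?thesis
        unfolding \<Sigma>_def nK by (simp add: has_real_derivative_iff_has_vector_derivative)
    qed
    have pos: "0 < \<Sigma> t" for t
      unfolding \<Sigma>_def nK using R(1) by simp
    have speed: "(norm (M' t))\<^sup>2 + (\<Sigma>' t)\<^sup>2 = d\<^sup>2 * (\<Sigma> t)\<^sup>2" for t
    proof -
      define T where "T = tanh (d * t + t0)"
      define C where "C = cosh (d * t + t0)"
      have "0 < C"
        by (simp add: C_def)
      have T: "1 - T\<^sup>2 = 1 / C\<^sup>2"
      proof -
        have "T\<^sup>2 = (C\<^sup>2 - 1) / C\<^sup>2"
          by (simp add: T_def C_def tanh_def power_divide sinh_square_eq)
        then show ?thesis
          using \<open>0 < C\<close> by (simp add: diff_divide_distrib)
      qed
      have "norm (m1 - m0) / K = R"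
        using nK n by simp
      have "(norm (M' t))\<^sup>2 = (d * (1 - T\<^sup>2) * (norm (m1 - m0) / K))\<^sup>2"
        by (simp add: M'_def T_def power_mult_distrib power_divide)
      also have "\<dots> = d\<^sup>2 * R\<^sup>2 * (1 - T\<^sup>2) * (1 / C\<^sup>2)"
        unfolding \<open>norm (m1 - m0) / K = R\<close> T[symmetric] by (simp add: power2_eq_square algebra_simps)
      finally have "(norm (M' t))\<^sup>2 + (\<Sigma>' t)\<^sup>2 = d\<^sup>2 * R\<^sup>2 * (1 - T\<^sup>2) * (1 / C\<^sup>2) + d\<^sup>2 * R\<^sup>2 * T\<^sup>2 * (1 / C\<^sup>2)"
        by (simp add: \<Sigma>'_def T_def C_def power_divide power_mult_distrib algebra_simps)
      also have "\<dots> = d\<^sup>2 * R\<^sup>2 * (1 / C\<^sup>2)"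
        by (simp add: algebra_simps)
      also have "\<dots> = d\<^sup>2 * (\<Sigma> t)\<^sup>2"
        unfolding \<Sigma>_def nK by (simp add: C_def power_divide)
      finally show ?thesis .
    qed
    have "(m has_vector_derivative M' t) (at t within {0..1})" "(\<sigma> has_vector_derivative \<Sigma>' t) (at t within {0..1})"
      if "t \<in> {0..1}" for t
      using has_vector_derivative_transform[OF that _ ddM, of m] has_vector_derivative_transform[OF that _ dd\<Sigma>, of \<sigma>]
        eq by auto
    moreover have "continuous_on {0..1} M'" "continuous_on {0..1} \<Sigma>'"
      unfolding M'_def \<Sigma>'_def using \<open>K \<noteq> 0\<close> by (auto intro!: continuous_intros)
    ultimately have ac: "abs_cont_on 0 1 m" "abs_cont_on 0 1 \<sigma>" "action m \<sigma> = ennreal (d\<^sup>2 / 2)"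
      using constant_speed_action[of m M' \<sigma> \<Sigma>' "d\<^sup>2"] eq pos speed by auto
    have "m 0 = m0" "m 1 = m1" "\<sigma> 0 = \<sigma>0" "\<sigma> 1 = \<sigma>1"
    proof -
      show "m 0 = m0" "m 1 = m1"
        using eq[of 0] eq[of 1] \<open>K \<noteq> 0\<close> by (auto simp: M_def K_def)
      show "\<sigma> 0 = \<sigma>0" "\<sigma> 1 = \<sigma>1"
        using eq[of 0] eq[of 1] R(1) var by (auto simp: \<Sigma>_def nK start finish)
    qed
    moreover have "0 \<le> \<sigma> t" if "t \<in> {0..1}" for t
      using eq[OF that] pos[of t] by simp
    ultimately show ?thesis
      using ac mean var by (simp add: admissible_def)
  qed
  have boundary: "arsinh (((m 1 - m0) \<bullet> e - c) / \<sigma> 1) - arsinh (((m 0 - m0) \<bullet> e - c) / \<sigma> 0) = d"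
    if "admissible \<mu>0 \<mu>1 m \<sigma>" for m \<sigma>
    using admissible_boundary[OF that var] that mean e(3) by (simp add: admissible_def d t0)
  have lower: "ennreal (d\<^sup>2 / 2) \<le> action m \<sigma>" if adm: "admissible \<mu>0 \<mu>1 m \<sigma>" for m \<sigma>
  proof (cases "action m \<sigma> < \<infinity>")
    case True
    have "\<And>t. t \<in> {0..1} \<Longrightarrow> 0 < \<sigma> t"
      using optimal_positive[OF adm _ True] admissible_boundary[OF adm var] var by simp
    then show ?thesis
      using hyperbolic_energy_bound(1)[of m \<sigma> e m0 c] adm e(1) boundary[OF adm] by (simp add: admissible_def)
  next
    case False
    then show ?thesis
      by (simp add: not_less top_unique)
  qed
  show Dvar_sq: "Dvar_sq \<mu>0 \<mu>1 = ennreal (d\<^sup>2 / 2)"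
    using curve[of M \<Sigma>] by (intro Dvar_sq_eqI[OF lower]) auto
  have unique: "m t = M t \<and> \<sigma> t = \<Sigma> t"
    if opt: "optimal_curve \<mu>0 \<mu>1 m \<sigma>" and t: "t \<in> {0..1}" for t
  proof -
    have adm: "admissible \<mu>0 \<mu>1 m \<sigma>" and act: "action m \<sigma> = ennreal (d\<^sup>2 / 2)"
      using opt Dvar_sq by (auto simp: optimal_curve_def)
    have pos: "\<And>t. t \<in> {0..1} \<Longrightarrow> 0 < \<sigma> t"
      using optimal_positive[OF adm] admissible_boundary[OF adm var] var act by simp
    define x where "x = (m t - m0) \<bullet> e - c"
    define \<theta> where "\<theta> = d * t + t0"
    have bd: "m 0 = m0" "\<sigma> 0 = \<sigma>0"
      using adm mean admissible_boundary[OF adm var] by (auto simp: admissible_def)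
    have "arsinh (((m 1 - m0) \<bullet> e - c) / \<sigma> 1) - arsinh (((m 0 - m0) \<bullet> e - c) / \<sigma> 0) = d"
      by (rule boundary[OF adm])
    from hyperbolic_energy_bound(2)[of m \<sigma> e m0 c t, unfolded this, OF _ _ pos e(1) act t] adm
    have ars: "arsinh (x / \<sigma> t) = \<theta>" and rad: "x\<^sup>2 + (\<sigma> t)\<^sup>2 = R\<^sup>2"
      and perp: "m t - (m t \<bullet> e) *\<^sub>R e = m0 - (m0 \<bullet> e) *\<^sub>R e"
      by (auto simp: admissible_def x_def \<theta>_def bd t0 R(2))
    have quot: "cosh \<theta> = R / \<sigma> t" "tanh \<theta> = x / R"
      using arsinh_quotient(2,3)[of "\<sigma> t" R x] pos[OF t] R(1) rad by (simp_all add: ars)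
    have "\<sigma> t = \<Sigma> t"
      unfolding \<Sigma>_def nK \<theta>_def[symmetric] quot using R(1) by simp
    moreover have "m t = M t"
    proof -
      have "m t = m0 + ((m t - m0) \<bullet> e) *\<^sub>R e"
        using perp by (simp add: inner_diff_left scaleR_diff_left algebra_simps)
      also have "(m t - m0) \<bullet> e = (tanh \<theta> - tanh t0) / K * n"
      proof -
        have "(tanh \<theta> - tanh t0) / K * n = (tanh \<theta> - tanh t0) * R"
          using nK(1) by (metis times_divide_eq_left times_divide_eq_right mult.commute)
        also have "\<dots> = x + c"
          unfolding quot start using R(1) by (simp add: field_simps)
        finally show ?thesis
          by (simp add: x_def)
      qed
      finally show ?thesis
        by (simp add: M_def \<theta>_def e(2))
    qed
    ultimately show ?thesis by simp
  qed
  have "optimal_curve \<mu>0 \<mu>1 m \<sigma> \<longleftrightarrow> (\<forall>t\<in>{0..1}. m t = M t \<and> \<sigma> t = \<Sigma> t)"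
  proof
    assume "\<forall>t\<in>{0..1}. m t = M t \<and> \<sigma> t = \<Sigma> t"
    then show "optimal_curve \<mu>0 \<mu>1 m \<sigma>"
      using curve[of m \<sigma>] Dvar_sq by (simp add: optimal_curve_def)
  qed (use unique in blast)
  then show "optimal_curve \<mu>0 \<mu>1 m \<sigma> \<longleftrightarrow>
      (\<forall>t\<in>{0..1}. m t = m0 + ((tanh (d * t + t0) - tanh t0) / (tanh (d + t0) - tanh t0)) *\<^sub>R (m1 - m0)
         \<and> \<sigma> t = n / (tanh (d + t0) - tanh t0) * (1 / cosh (d * t + t0)))"
    unfolding M_def \<Sigma>_def K_def .
qed

text \<open>For equal means the geodesic is the vertical segment over the common mean, and its arc
  length is the increment of \<open>ln \<sigma>\<close>, the calibrating function.\<close>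

lemma vertical_optimal:
  fixes \<mu>0 \<mu>1 :: "'a::euclidean_space measure"
  assumes mean: "m0 = mean \<mu>0" "m0 = mean \<mu>1"
    and var: "0 < \<sigma>0" "\<sigma>0\<^sup>2 = var \<mu>0" "0 < \<sigma>1" "\<sigma>1\<^sup>2 = var \<mu>1"
  shows "Dvar_sq \<mu>0 \<mu>1 = ennreal ((ln \<sigma>1 - ln \<sigma>0)\<^sup>2 / 2)"
    and "optimal_curve \<mu>0 \<mu>1 m \<sigma> \<longleftrightarrow> (\<forall>t\<in>{0..1}. m t = m0 \<and> \<sigma> t = \<sigma>0 powr (1 - t) * \<sigma>1 powr t)"
proof -
  define d where "d = ln \<sigma>1 - ln \<sigma>0"
  define \<Sigma> where "\<Sigma> t = \<sigma>0 powr (1 - t) * \<sigma>1 powr t" for t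
  have \<Sigma>_exp: "\<Sigma> t = exp (ln \<sigma>0 + t * d)" for t
  proof -
    have "ln \<sigma>0 + t * d = (1 - t) * ln \<sigma>0 + t * ln \<sigma>1"
      by (simp add: d_def algebra_simps)
    then show ?thesis
      using var(1,3) by (simp add: \<Sigma>_def powr_def exp_add)
  qed
  have curve: "admissible \<mu>0 \<mu>1 m \<sigma> \<and> action m \<sigma> = ennreal (d\<^sup>2 / 2)"
    if eq: "\<And>t. t \<in> {0..1} \<Longrightarrow> m t = m0 \<and> \<sigma> t = \<Sigma> t" for m \<sigma>
  proof -
    have "((\<lambda>t. exp (ln \<sigma>0 + t * d)) has_real_derivative d * \<Sigma> t) (at t within {0..1})" for t
      unfolding \<Sigma>_exp by (auto intro!: derivative_eq_intros)
    then have dd\<Sigma>: "(\<Sigma> has_vector_derivative d * \<Sigma> t) (at t within {0..1})" for t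
      by (simp add: \<Sigma>_exp[abs_def] has_real_derivative_iff_has_vector_derivative)
    have "(m has_vector_derivative 0) (at t within {0..1})" "(\<sigma> has_vector_derivative d * \<Sigma> t) (at t within {0..1})"
      if "t \<in> {0..1}" for t
      using has_vector_derivative_transform[OF that _ has_vector_derivative_const[of m0], of m]
        has_vector_derivative_transform[OF that _ dd\<Sigma>, of \<sigma>] eq by auto
    moreover have "continuous_on {0..1} (\<lambda>t. d * \<Sigma> t)"
      unfolding \<Sigma>_exp by (intro continuous_intros)
    ultimately have ac: "abs_cont_on 0 1 m" "abs_cont_on 0 1 \<sigma>" "action m \<sigma> = ennreal (d\<^sup>2 / 2)"
      using constant_speed_action[of m "\<lambda>_. 0" \<sigma> "\<lambda>t. d * \<Sigma> t" "d\<^sup>2"] eq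
      by (auto simp: \<Sigma>_exp power_mult_distrib)
    have "m 0 = m0" "m 1 = m0" "\<sigma> 0 = \<sigma>0" "\<sigma> 1 = \<sigma>1"
      using eq[of 0] eq[of 1] var by (auto simp: \<Sigma>_def)
    moreover have "0 \<le> \<sigma> t" if "t \<in> {0..1}" for t
      using eq[OF that] by (simp add: \<Sigma>_exp)
    ultimately show ?thesis
      using ac mean var by (simp add: admissible_def)
  qed
  have energy: "ennreal (d\<^sup>2 / 2) \<le> action m \<sigma>"
      "\<lbrakk>action m \<sigma> = ennreal (d\<^sup>2 / 2); t \<in> {0..1}\<rbrakk> \<Longrightarrow> ln (\<sigma> t) = ln \<sigma>0 + t * d \<and> m t = m0"
    if adm: "admissible \<mu>0 \<mu>1 m \<sigma>" and pos: "\<And>t. t \<in> {0..1} \<Longrightarrow> 0 < \<sigma> t" for m \<sigma> t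
  proof -
    have ac: "abs_cont_on 0 1 m" "abs_cont_on 0 1 \<sigma>" and "m 0 = m0"
      using adm mean by (simp_all add: admissible_def)
    note bound = log_energy_bound[where b = 1, OF ac zero_less_one order_refl pos, folded action_def,
        unfolded admissible_boundary[OF adm var] mult_1_right div_by_1 \<open>m 0 = m0\<close>, folded d_def]
    show "ennreal (d\<^sup>2 / 2) \<le> action m \<sigma>"
      by (rule bound(1))
    show "ln (\<sigma> t) = ln \<sigma>0 + t * d \<and> m t = m0" if "action m \<sigma> = ennreal (d\<^sup>2 / 2)" "t \<in> {0..1}"
      by (rule bound(2)[OF _ that])
  qed
  have lower: "ennreal (d\<^sup>2 / 2) \<le> action m \<sigma>" if adm: "admissible \<mu>0 \<mu>1 m \<sigma>" for m \<sigma>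
  proof (cases "action m \<sigma> < \<infinity>")
    case True
    then show ?thesis
      using energy(1)[OF adm] optimal_positive[OF adm _ True] admissible_boundary[OF adm var] var by simp
  next
    case False
    then show ?thesis
      by (simp add: not_less top_unique)
  qed
  have Dvar_sq: "Dvar_sq \<mu>0 \<mu>1 = ennreal (d\<^sup>2 / 2)"
    using curve[of "\<lambda>_. m0" \<Sigma>] by (intro Dvar_sq_eqI[OF lower]) auto
  then show "Dvar_sq \<mu>0 \<mu>1 = ennreal ((ln \<sigma>1 - ln \<sigma>0)\<^sup>2 / 2)"
    by (simp add: d_def)
  have unique: "m t = m0 \<and> \<sigma> t = \<Sigma> t"
    if opt: "optimal_curve \<mu>0 \<mu>1 m \<sigma>" and t: "t \<in> {0..1}" for t
  proof -
    have adm: "admissible \<mu>0 \<mu>1 m \<sigma>" and act: "action m \<sigma> = ennreal (d\<^sup>2 / 2)"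
      using opt Dvar_sq by (auto simp: optimal_curve_def)
    have pos: "\<And>t. t \<in> {0..1} \<Longrightarrow> 0 < \<sigma> t"
      using optimal_positive[OF adm] admissible_boundary[OF adm var] var act by simp
    have "ln (\<sigma> t) = ln \<sigma>0 + t * d \<and> m t = m0"
      by (rule energy(2)[OF adm pos act t])
    then show ?thesis
      using pos[OF t] by (metis \<Sigma>_exp exp_ln)
  qed
  have "optimal_curve \<mu>0 \<mu>1 m \<sigma> \<longleftrightarrow> (\<forall>t\<in>{0..1}. m t = m0 \<and> \<sigma> t = \<Sigma> t)"
  proof
    assume "\<forall>t\<in>{0..1}. m t = m0 \<and> \<sigma> t = \<Sigma> t"
    then show "optimal_curve \<mu>0 \<mu>1 m \<sigma>"
      using curve[of m \<sigma>] Dvar_sq by (simp add: optimal_curve_def)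
  qed (use unique in blast)
  then show "optimal_curve \<mu>0 \<mu>1 m \<sigma> \<longleftrightarrow> (\<forall>t\<in>{0..1}. m t = m0 \<and> \<sigma> t = \<sigma>0 powr (1 - t) * \<sigma>1 powr t)"
    unfolding \<Sigma>_def .
qed

theorem theorem1p35:
  fixes \<mu>0 \<mu>1 :: "(real ^ 'd) measure" and m0 m1 :: "real ^ 'd" and \<sigma>0 \<sigma>1 n \<beta> t0 :: real
  assumes "\<mu>0 \<in> P2" and "\<mu>1 \<in> P2"
    and "m0 = mean \<mu>0" and "m1 = mean \<mu>1"
    and "\<sigma>0 > 0" and "\<sigma>0\<^sup>2 = var \<mu>0" and "\<sigma>1 > 0" and "\<sigma>1\<^sup>2 = var \<mu>1"
    and "n = norm (m1 - m0)"
    and "\<beta> = sqrt 2 * Dvar \<mu>0 \<mu>1"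
    and "t0 = ln ((\<sigma>0\<^sup>2 - \<sigma>1\<^sup>2 - n\<^sup>2 + sqrt ((n\<^sup>2 + \<sigma>0\<^sup>2 + \<sigma>1\<^sup>2)\<^sup>2 - 4 * \<sigma>0\<^sup>2 * \<sigma>1\<^sup>2)) / (2 * n * \<sigma>0))"
  shows "Dvar_sq \<mu>0 \<mu>1 = ennreal (1 / 2 * \<bar>ln ((n\<^sup>2 + \<sigma>0\<^sup>2 + \<sigma>1\<^sup>2
             - sqrt ((n\<^sup>2 + \<sigma>0\<^sup>2 + \<sigma>1\<^sup>2)\<^sup>2 - 4 * \<sigma>0\<^sup>2 * \<sigma>1\<^sup>2)) / (2 * \<sigma>0 * \<sigma>1))\<bar>\<^sup>2)
    \<and> \<beta> \<ge> 0
    \<and> (n > 0 \<longrightarrow>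
         (t0 \<ge> 0 \<longleftrightarrow> n\<^sup>2 + \<sigma>1\<^sup>2 \<le> \<sigma>0\<^sup>2)
         \<and> (\<forall>m \<sigma>. optimal_curve \<mu>0 \<mu>1 m \<sigma> \<longleftrightarrow>
              (\<forall>t\<in>{0..1}.
                 m t = m0 + ((tanh (\<beta> * t + t0) - tanh t0) / (tanh (\<beta> + t0) - tanh t0)) *\<^sub>R (m1 - m0)
                 \<and> \<sigma> t = n / (tanh (\<beta> + t0) - tanh t0) * (1 / cosh (\<beta> * t + t0)))))
    \<and> (n = 0 \<longrightarrow>
         (\<forall>m \<sigma>. optimal_curve \<mu>0 \<mu>1 m \<sigma> \<longleftrightarrow>
            (\<forall>t\<in>{0..1}. m t = m0 \<and> \<sigma> t = \<sigma>0 powr (1 - t) * \<sigma>1 powr t)))"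
    (is "Dvar_sq \<mu>0 \<mu>1 = ennreal (1 / 2 * ?L\<^sup>2) \<and> _")
proof (cases "n = 0")
  case True
  have "m0 = mean \<mu>1"
    using True assms(4,9) by simp
  note vertical = vertical_optimal[OF assms(3) this assms(5-8)]
  have "?L = \<bar>ln \<sigma>1 - ln \<sigma>0\<bar>"
  proof -
    have "(n\<^sup>2 + \<sigma>0\<^sup>2 + \<sigma>1\<^sup>2)\<^sup>2 - 4 * \<sigma>0\<^sup>2 * \<sigma>1\<^sup>2 = (\<sigma>0\<^sup>2 - \<sigma>1\<^sup>2)\<^sup>2"
      using True by (simp add: power2_eq_square algebra_simps)
    then have root: "sqrt ((n\<^sup>2 + \<sigma>0\<^sup>2 + \<sigma>1\<^sup>2)\<^sup>2 - 4 * \<sigma>0\<^sup>2 * \<sigma>1\<^sup>2) = \<bar>\<sigma>0\<^sup>2 - \<sigma>1\<^sup>2\<bar>"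
      by simp
    show ?thesis
    proof (cases "\<sigma>0 \<le> \<sigma>1")
      case le: True
      then have "\<bar>\<sigma>0\<^sup>2 - \<sigma>1\<^sup>2\<bar> = \<sigma>1\<^sup>2 - \<sigma>0\<^sup>2"
        using assms(5) power_mono[OF le, of 2] by simp
      then have "(n\<^sup>2 + \<sigma>0\<^sup>2 + \<sigma>1\<^sup>2 - \<bar>\<sigma>0\<^sup>2 - \<sigma>1\<^sup>2\<bar>) / (2 * \<sigma>0 * \<sigma>1) = \<sigma>0 / \<sigma>1"
        using True assms(5,7) by (simp add: power2_eq_square)
      then show ?thesis
        unfolding root using assms(5,7) by (simp add: ln_div abs_minus_commute)
    next
      case False
      then have "\<bar>\<sigma>0\<^sup>2 - \<sigma>1\<^sup>2\<bar> = \<sigma>0\<^sup>2 - \<sigma>1\<^sup>2"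
        using assms(7) power_mono[of \<sigma>1 \<sigma>0 2] by simp
      then have "(n\<^sup>2 + \<sigma>0\<^sup>2 + \<sigma>1\<^sup>2 - \<bar>\<sigma>0\<^sup>2 - \<sigma>1\<^sup>2\<bar>) / (2 * \<sigma>0 * \<sigma>1) = \<sigma>1 / \<sigma>0"
        using True assms(5,7) by (simp add: power2_eq_square)
      then show ?thesis
        unfolding root using assms(5,7) by (simp add: ln_div)
    qed
  qed
  then have "Dvar_sq \<mu>0 \<mu>1 = ennreal (1 / 2 * ?L\<^sup>2)"
    using vertical(1) by simp
  moreover have "0 \<le> \<beta>"
    by (simp add: assms(10) Dvar_def)
  ultimately show ?thesis
    using True vertical(2) by simp
next
  case False
  then have "0 < n"
    using assms(9) by simp
  define c where "c = (n\<^sup>2 + \<sigma>1\<^sup>2 - \<sigma>0\<^sup>2) / (2 * n)"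
  define R where "R = sqrt (c\<^sup>2 + \<sigma>0\<^sup>2)"
  note param = semicircle_parameters[OF \<open>0 < n\<close> assms(5,7) c_def R_def]
  have t0: "t0 = arsinh (- c / \<sigma>0)"
    unfolding assms(11) by (rule param(4))
  define d where "d = arsinh ((n - c) / \<sigma>1) - t0"
  note optimal = semicircle_optimal[OF assms(3,4,9) \<open>0 < n\<close> assms(5-8) param(1-3) t0 d_def]
  have "d = ?L" "0 < d"
    unfolding d_def t0 by (rule param(6), rule param(7))
  have "Dvar_sq \<mu>0 \<mu>1 = ennreal (1 / 2 * ?L\<^sup>2)"
    using optimal(1) unfolding \<open>d = ?L\<close> by simp
  moreover have "\<beta> = d"
    using \<open>0 < d\<close> by (simp add: assms(10) Dvar_def optimal(1) real_sqrt_divide)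
  moreover have "0 \<le> t0 \<longleftrightarrow> n\<^sup>2 + \<sigma>1\<^sup>2 \<le> \<sigma>0\<^sup>2"
    unfolding t0 by (rule param(5))
  ultimately show ?thesis
    using \<open>0 < n\<close> \<open>0 < d\<close> optimal(2) by simp
qed

end
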